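(* There exists a universal constant $\epsilon_1>0$ such that if $(u,\psi)$ solves weakly $$D\psi=-e^{u}\psi\quad\text{in }\mathbb R^2\setminus\{0\}$$ and satisfies $$\int_{\mathbb R^2}e^{2u}\le\epsilon_1,\qquad \int_{\mathbb R^2}|\psi|^4<\infty,$$ then $\psi\equiv0$ on $\mathbb R^2$.
   Context: Here $u$ is a real-valued function and $\psi$ a spinor on the Euclidean plane. On $\mathbb R^2$ (and on $\mathbb R^2\setminus\{0\}$ with the restricted spin structure) spinors are $\mathbb C^2$-valued functions, and the Dirac operator is $D\psi=e_1\cdot\partial_1\psi+e_2\cdot\partial_2\psi$, where $e_1\cdot,e_2\cdot$ are constant skew-Hermitian $2\times2$ matrices with $e_i\cdot e_j\cdot+e_j\cdot e_i\cdot=-2\delta_{ij}$. "Weakly" means in the sense of distributions on $\mathbb R^2\setminus\{0\}$. *)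

theory Defs
  imports "HOL-Analysis.Analysis"
begin

type_synonym plane = "real^2"
type_synonym spinor = "complex^2"

definition skew_hermitian :: "complex^'n^'n \<Rightarrow> bool" where
  "skew_hermitian A \<longleftrightarrow> (\<forall>i j. cnj (A $ j $ i) = - A $ i $ j)"

text \<open>Here \<open>mat c\<close> is the scalar matrix \<open>c\<close> times the identity.\<close>

definition clifford :: "(2 \<Rightarrow> complex^2^2) \<Rightarrow> bool" where
  "clifford e \<longleftrightarrow>
     (\<forall>i. skew_hermitian (e i)) \<and>
     (\<forall>i j. e i ** e j + e j ** e i = mat (if i = j then - 2 else 0))"

fun C_k :: "nat \<Rightarrow> ('a::real_normed_vector \<Rightarrow> 'b::real_normed_vector) \<Rightarrow> bool" where
  "C_k 0 f \<longleftrightarrow> continuous_on UNIV f"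
| "C_k (Suc k) f \<longleftrightarrow>
     (\<forall>x. f differentiable (at x)) \<and> (\<forall>v. C_k k (\<lambda>x. frechet_derivative f (at x) v))"

text \<open>Test functions on an open set \<open>U\<close>, extended by zero to the whole plane.\<close>

definition test_functions :: "plane set \<Rightarrow> (plane \<Rightarrow> real) set" where
  "test_functions U =
     {\<phi>. (\<forall>k. C_k k \<phi>) \<and> compact (closure {x. \<phi> x \<noteq> 0}) \<and> closure {x. \<phi> x \<noteq> 0} \<subseteq> U}"

definition locally_integrable_on ::
    "(plane \<Rightarrow> 'b::{banach, second_countable_topology}) \<Rightarrow> plane set \<Rightarrow> bool" where
  "locally_integrable_on f U \<longleftrightarrow> (\<forall>K. compact K \<and> K \<subseteq> U \<longrightarrow> set_integrable lebesgue K f)"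

text \<open>
  Spinor-valued distributions are represented by their action on test functions. The
  following three definitions are the regular distribution of a function, the partial
  derivative of a distribution, and the Dirac operator on distributions.
\<close>

definition distr_of :: "(plane \<Rightarrow> spinor) \<Rightarrow> (plane \<Rightarrow> real) \<Rightarrow> spinor" where
  "distr_of f \<phi> = (LINT x|lebesgue. \<phi> x *\<^sub>R f x)"

definition distr_partial ::
    "2 \<Rightarrow> ((plane \<Rightarrow> real) \<Rightarrow> spinor) \<Rightarrow> (plane \<Rightarrow> real) \<Rightarrow> spinor" where
  "distr_partial i T \<phi> = - T (\<lambda>x. frechet_derivative \<phi> (at x) (axis i 1))"

definition distr_dirac ::
    "(2 \<Rightarrow> complex^2^2) \<Rightarrow> ((plane \<Rightarrow> real) \<Rightarrow> spinor) \<Rightarrow> (plane \<Rightarrow> real) \<Rightarrow> spinor" where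
  "distr_dirac e T \<phi> = (\<Sum>i\<in>UNIV. e i *v distr_partial i T \<phi>)"

text \<open>
  \<open>D \<psi> = - e\<^sup>u \<psi>\<close> in the sense of distributions on \<open>U\<close>. Local integrability of both
  sides is what makes them distributions on \<open>U\<close>; without it the Bochner integrals would
  silently be zero.
\<close>

definition weak_dirac_solution_on ::
    "plane set \<Rightarrow> (2 \<Rightarrow> complex^2^2) \<Rightarrow> (plane \<Rightarrow> real) \<Rightarrow> (plane \<Rightarrow> spinor) \<Rightarrow> bool" where
  "weak_dirac_solution_on U e u \<psi> \<longleftrightarrow>
     locally_integrable_on \<psi> U \<and>
     locally_integrable_on (\<lambda>x. exp (u x) *\<^sub>R \<psi> x) U \<and>
     (\<forall>\<phi>\<in>test_functions U.
        distr_dirac e (distr_of \<psi>) \<phi> = distr_of (\<lambda>x. - (exp (u x) *\<^sub>R \<psi> x)) \<phi>)"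

end

theory Submission
  imports Defs "HOL-Computational_Algebra.Polynomial"
begin

text \<open>
  Write \<open>f = e\<^sup>u \<psi>\<close>. Testing the equation with the gradient of the regularised logarithm
  \<open>1/2 log (\<bar>x - a\<bar>\<^sup>2 + d\<^sup>2)\<close> and using \<open>D\<^sup>2 = - \<Delta>\<close> bounds a mollification of \<open>\<psi>\<close> at \<open>a\<close>
  by \<open>\<integral> \<bar>f(x)\<bar> / \<bar>x - a\<bar> dx\<close>. The cutoffs at the origin and at infinity which make this an admissible
  test function do no harm, because \<open>\<psi> \<in> L\<^sup>4\<close>. Letting \<open>d\<close> tend to zero weakly, the
  Hardy-Littlewood-Sobolev inequality \<open>L\<^sup>4\<^sup>/\<^sup>3 \<rightarrow> L\<^sup>4\<close> for the kernel \<open>1 / \<bar>x\<bar>\<close> and Hoelder's inequality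
  yield \<open>\<parallel>\<psi>\<parallel>\<^sub>4 \<le> C \<parallel>f\<parallel>\<^sub>4\<^sub>/\<^sub>3 \<le> C \<parallel>e\<^sup>u\<parallel>\<^sub>2 \<parallel>\<psi>\<parallel>\<^sub>4\<close>, which forces \<open>\<psi> = 0\<close> once \<open>\<parallel>e\<^sup>u\<parallel>\<^sub>2\<close> is small.
\<close>

section \<open>Smooth functions\<close>

text \<open>The point singularity is harmless because the gradient of a cutoff at radius 1/n has
  size n on a disc of area of order n^(-2): its L^(4/3) norm is of order n^(-1/2), and L^(4/3) is
  dual to L^4. At radius n the cutoff gradient has size 1/n on area n^2, but there it multiplies a
  Green gradient of size 1/n, which gives n^(-1/2) again. The kernel 1/|x - a| is never tested
  directly: for d > 0 its regularisation is smooth, and the singular kernel enters only as an upper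
  bound independent of d. The weak limit is taken by pairing with a scalar weight g; the mollifier
  is moved onto g, so no convergence of mollified spinors is needed, and finally g is the truncated
  cube of a component of \<psi>. The exponents are forced: replacing u(x) by u(sx) + log s and
  \<psi>(x) by s^(1/2) \<psi>(sx) preserves the equation and both integrals, which is why a
  universal threshold can exist. Absorbing the right-hand side into the left relies on the L^4
  integral of \<psi> being finite.\<close>

definition smooth :: "('a::real_normed_vector \<Rightarrow> 'b::real_normed_vector) \<Rightarrow> bool" where
  "smooth f \<longleftrightarrow> (\<forall>k. C_k k f)"

lemma C_k_Suc_imp: "C_k (Suc k) f \<Longrightarrow> C_k k f"
proof (induction k arbitrary: f)
  case 0
  then show ?case
    by (auto simp: continuous_on_eq_continuous_within intro!: differentiable_imp_continuous_within)
next
  case (Suc k)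
  then show ?case by simp
qed

lemma C_k_SucI:
  assumes "\<And>x. (f has_derivative f' x) (at x)" and "\<And>v. C_k k (\<lambda>x. f' x v)"
  shows "C_k (Suc k) f"
proof -
  have "frechet_derivative f (at x) = f' x" for x
    using frechet_derivative_at[OF assms(1)] by simp
  with assms show ?thesis by (auto simp: differentiable_def)
qed

lemma C_k_Suc_derivative:
  "C_k (Suc k) f \<Longrightarrow> (f has_derivative frechet_derivative f (at x)) (at x)"
  by (simp add: frechet_derivative_works)

lemma C_k_const: "C_k k (\<lambda>x. c)"
proof (induction k arbitrary: c)
  case (Suc k)
  show ?case by (rule C_k_SucI[where f'="\<lambda>x v. 0"]) (auto intro: Suc)
qed simp

lemma C_k_linear: "bounded_linear f \<Longrightarrow> C_k k f"
proof (cases k)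
  case (Suc l)
  assume "bounded_linear f"
  then show ?thesis unfolding Suc
    by (intro C_k_SucI[where f'="\<lambda>x v. f v"]) (auto intro: C_k_const bounded_linear_imp_has_derivative)
qed (simp add: linear_continuous_on)

lemma C_k_add: "C_k k f \<Longrightarrow> C_k k g \<Longrightarrow> C_k k (\<lambda>x. f x + g x)"
proof (induction k arbitrary: f g)
  case (Suc k)
  show ?case
    by (intro C_k_SucI[OF has_derivative_add[OF C_k_Suc_derivative C_k_Suc_derivative]] Suc.prems
      Suc.IH) (use Suc.prems in auto)
qed (simp add: continuous_on_add)

lemma C_k_mult:
  fixes f g :: "'a::real_normed_vector \<Rightarrow> real"
  shows "C_k k f \<Longrightarrow> C_k k g \<Longrightarrow> C_k k (\<lambda>x. f x * g x)"
proof (induction k arbitrary: f g)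
  case (Suc k)
  have "C_k k f" "C_k k g" using Suc.prems C_k_Suc_imp by blast+
  then show ?case
    by (intro C_k_SucI[OF has_derivative_mult[OF C_k_Suc_derivative C_k_Suc_derivative]] Suc.prems
      C_k_add Suc.IH) (use Suc.prems in auto)
qed (simp add: continuous_on_mult)

text \<open>A linear map on the reals is multiplication by its value at 1, so the chain rule gives a
  product of a derivative of \<open>f\<close> with the derivative of \<open>p\<close> composed with
  \<open>f\<close>. The induction must therefore generalise over \<open>p\<close>.\<close>

lemma C_k_compose:
  fixes p :: "real \<Rightarrow> real" and f :: "'a::real_normed_vector \<Rightarrow> real"
  shows "C_k k p \<Longrightarrow> C_k k f \<Longrightarrow> C_k k (\<lambda>x. p (f x))"
proof (induction k arbitrary: p f)
  case (Suc k)
  have f: "C_k k f" using Suc.prems C_k_Suc_imp by blast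
  have "((\<lambda>x. p (f x)) has_derivative
      (\<lambda>v. frechet_derivative f (at x) v * frechet_derivative p (at (f x)) 1)) (at x)" for x
  proof -
    have 1: "(p has_derivative frechet_derivative p (at (f x))) (at (f x))"
      using Suc.prems by (intro C_k_Suc_derivative)
    interpret p: linear "frechet_derivative p (at (f x))"
      using 1 by (rule has_derivative_linear)
    have "frechet_derivative p (at (f x)) = (\<lambda>h. h * frechet_derivative p (at (f x)) 1)"
    proof
      show "frechet_derivative p (at (f x)) h = h * frechet_derivative p (at (f x)) 1" for h
        using p.scale[of h 1] by simp
    qed
    with 1 have "(p has_derivative (\<lambda>h. h * frechet_derivative p (at (f x)) 1)) (at (f x))" by simp
    from has_derivative_compose[OF C_k_Suc_derivative[OF Suc.prems(2)] this] show ?thesis .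
  qed
  then show ?case
    by (rule_tac C_k_SucI, assumption, intro C_k_mult Suc.IH[of "\<lambda>y. frechet_derivative p (at y) 1" f] f)
      (use Suc.prems in auto)
qed (auto intro: continuous_on_compose2)

text \<open>The derivative -f'/f^2 contains 1/f only undifferentiated, so the induction can keep
  \<open>f\<close> fixed.\<close>

lemma C_k_inverse:
  fixes f :: "'a::real_normed_vector \<Rightarrow> real"
  assumes nz: "\<And>x. f x \<noteq> 0"
  shows "C_k k f \<Longrightarrow> C_k k (\<lambda>x. inverse (f x))"
proof (induction k)
  case 0
  then show ?case using nz by (simp add: continuous_on_inverse)
next
  case (Suc k)
  have "C_k k (\<lambda>x. inverse (f x))" using Suc C_k_Suc_imp by blast
  moreover have "((\<lambda>x. inverse (f x)) has_derivative
      (\<lambda>h. (-1) * (inverse (f x) * frechet_derivative f (at x) h * inverse (f x)))) (at x)" for x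
    using Deriv.has_derivative_inverse[OF nz C_k_Suc_derivative[OF Suc.prems]] by simp
  moreover have "C_k k (\<lambda>x. frechet_derivative f (at x) v)" for v using Suc.prems by simp
  ultimately show ?case
    by (rule_tac C_k_SucI) (assumption, intro C_k_mult C_k_const)
qed

lemma smooth_const: "smooth (\<lambda>x. c)"
  and smooth_linear: "bounded_linear l \<Longrightarrow> smooth l"
  and smooth_add: "smooth f \<Longrightarrow> smooth g \<Longrightarrow> smooth (\<lambda>x. f x + g x)"
  by (auto simp: smooth_def C_k_const C_k_linear C_k_add)

lemma smooth_mult:
  fixes f g :: "'a::real_normed_vector \<Rightarrow> real"
  shows "smooth f \<Longrightarrow> smooth g \<Longrightarrow> smooth (\<lambda>x. f x * g x)"
  by (auto simp: smooth_def C_k_mult)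

lemma smooth_compose:
  fixes p :: "real \<Rightarrow> real" and f :: "'a::real_normed_vector \<Rightarrow> real"
  shows "smooth p \<Longrightarrow> smooth f \<Longrightarrow> smooth (\<lambda>x. p (f x))"
  by (auto simp: smooth_def C_k_compose)

lemma smooth_inverse:
  fixes f :: "'a::real_normed_vector \<Rightarrow> real"
  shows "smooth f \<Longrightarrow> (\<And>x. f x \<noteq> 0) \<Longrightarrow> smooth (\<lambda>x. inverse (f x))"
  by (auto simp: smooth_def C_k_inverse)

lemma smooth_diff:
  fixes f g :: "'a::real_normed_vector \<Rightarrow> real"
  assumes "smooth f" "smooth g" shows "smooth (\<lambda>x. f x - g x)"
  using smooth_add[OF assms(1) smooth_mult[OF smooth_const[of "-1"] assms(2)]] by simp

lemma smooth_norm_sq: "smooth (\<lambda>x::real^2. (norm (x - a))\<^sup>2)"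
proof -
  have "smooth (\<lambda>x::real^2. x $ i)" for i by (intro smooth_linear bounded_linear_vec_nth)
  then have "smooth (\<lambda>x::real^2. (x$1 - a$1) * (x$1 - a$1) + (x$2 - a$2) * (x$2 - a$2))"
    by (intro smooth_add smooth_mult smooth_diff smooth_const)
  then show ?thesis
    by (simp add: norm_vec_def L2_set_def sum_2 power2_eq_square)
qed

text \<open>All derivatives of \<open>exp (- 1 / t)\<close> belong to this family.\<close>

definition flat :: "real poly \<Rightarrow> real \<Rightarrow> real" where
  "flat p t = (if t > 0 then poly p (inverse t) * exp (- inverse t) else 0)"

lemma flat_tendsto_0: "((\<lambda>t. poly p (inverse t) * exp (- inverse t)) \<longlongrightarrow> 0) (at_right (0::real))"
proof -
  have "((\<lambda>x. poly p x * exp (- x)) \<longlongrightarrow> 0) at_top" for p :: "real poly"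
  proof -
    have "((\<lambda>x. \<Sum>i\<le>degree p. coeff p i * (x ^ i / exp x)) \<longlongrightarrow> (\<Sum>i\<le>degree p. coeff p i * 0)) at_top"
      by (intro tendsto_intros tendsto_power_div_exp_0)
    then show ?thesis
      by (simp add: poly_altdef exp_minus sum_divide_distrib divide_inverse sum_distrib_right mult.assoc)
  qed
  then show ?thesis
    by (rule filterlim_compose[OF _ filterlim_inverse_at_top_right])
qed

text \<open>With x = 1/t, differentiating p(x) exp(-x) brings out dx/dt = -x^2 and hence the
  polynomial x^2 (p - p'). Since this stays in the family, smoothness follows by induction.\<close>

lemma flat_has_derivative:
  "(flat p has_real_derivative flat ([:0, 0, 1:] * (p - pderiv p)) t) (at t)"
proof -
  consider "t > 0" | "t < 0" | "t = 0" by linarith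
  then show ?thesis
  proof cases
    case 1
    have "((\<lambda>t. poly p (inverse t) * exp (- inverse t)) has_real_derivative
        flat ([:0, 0, 1:] * (p - pderiv p)) t) (at t)"
      using 1 by (auto intro!: derivative_eq_intros simp: flat_def field_simps power2_eq_square)
    moreover have "eventually (\<lambda>s. flat p s = poly p (inverse s) * exp (- inverse s)) (nhds t)"
      by (rule eventually_mono[OF eventually_nhds_in_open[of "{0<..}" t]]) (use 1 in \<open>auto simp: flat_def\<close>)
    ultimately show ?thesis by (subst DERIV_cong_ev[OF refl _ refl])
  next
    case 2
    then have "eventually (\<lambda>s. flat p s = 0) (nhds t)"
      by (intro eventually_mono[OF eventually_nhds_in_open[of "{..<0}" t]]) (use 2 in \<open>auto simp: flat_def\<close>)
    moreover have "flat ([:0, 0, 1:] * (p - pderiv p)) t = 0" using 2 by (simp add: flat_def)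
    ultimately show ?thesis using DERIV_cong_ev[OF refl _ refl, of "flat p" "\<lambda>_. 0" t 0] by simp
  next
    case 3
    have "((\<lambda>h. flat p h / h) \<longlongrightarrow> 0) (at 0)"
      unfolding filterlim_at_split
    proof
      show "((\<lambda>h. flat p h / h) \<longlongrightarrow> 0) (at_left 0)"
        by (rule tendsto_eventually) (auto simp: flat_def eventually_at_filter)
      \<comment> \<open>To the right of 0 the difference quotient is again of this form, with
        polynomial x p.\<close>
      show "((\<lambda>h. flat p h / h) \<longlongrightarrow> 0) (at_right 0)"
        by (rule Lim_transform_eventually[OF flat_tendsto_0[of "[:0,1:] * p"]])
          (auto simp: flat_def eventually_at_filter field_simps)
    qed
    then show ?thesis using 3 by (simp add: DERIV_def flat_def)
  qed
qed

lemma smooth_flat: "smooth (flat p)"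
proof -
  have "C_k k (flat p)" for k p
  proof (induction k arbitrary: p)
    case 0
    show ?case using DERIV_isCont[OF flat_has_derivative] by (simp add: continuous_at_imp_continuous_on)
  next
    case (Suc k)
    show ?case
      by (rule C_k_SucI[OF flat_has_derivative[unfolded has_field_derivative_def]])
        (intro C_k_mult C_k_const Suc)
  qed
  then show ?thesis by (simp add: smooth_def)
qed

text \<open>The usual smooth transition from 0 to 1 on the unit interval. As \<open>t\<close> and
  \<open>1 - t\<close> are never both nonpositive, the denominator is positive.\<close>

definition step :: "real \<Rightarrow> real" where
  "step t = flat 1 t * inverse (flat 1 t + flat 1 (1 - t))"

lemma flat_1_pos: "t > 0 \<Longrightarrow> flat 1 t > 0" and flat_1_nonpos: "t \<le> 0 \<Longrightarrow> flat 1 t = 0"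
  by (auto simp: flat_def)

lemma flat_1_nonneg: "flat 1 t \<ge> 0"
  by (simp add: flat_def)

lemma step_denom: "flat 1 t + flat 1 (1 - t) > 0"
  using flat_1_nonneg[of t] flat_1_nonneg[of "1 - t"] flat_1_pos[of t] flat_1_pos[of "1 - t"]
  by (cases "t > 0") auto

lemma step_eq_0: "t \<le> 0 \<Longrightarrow> step t = 0"
  by (simp add: step_def flat_1_nonpos)

lemma step_eq_1: "t \<ge> 1 \<Longrightarrow> step t = 1"
  using step_denom[of t] by (simp add: step_def flat_1_nonpos)

lemma step_bounds: "0 \<le> step t" "step t \<le> 1"
  using step_denom[of t] flat_1_nonneg[of t] flat_1_nonneg[of "1 - t"]
  by (auto simp: step_def field_simps)

lemma smooth_step: "smooth step"
proof -
  have "smooth (\<lambda>t::real. t)" by (simp add: smooth_linear)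
  then have "smooth (\<lambda>t. flat 1 (1 - t))"
    by (intro smooth_compose[OF smooth_flat] smooth_diff smooth_const)
  then show ?thesis unfolding step_def[abs_def] using step_denom
    by (intro smooth_mult smooth_inverse smooth_add smooth_flat) (auto simp: less_imp_neq[symmetric])
qed

lemma step_has_derivative: "(step has_real_derivative deriv step t) (at t)"
proof -
  have "C_k (Suc 0) step" using smooth_step by (simp only: smooth_def)
  then show ?thesis by (simp add: DERIV_deriv_iff_real_differentiable)
qed

lemma continuous_on_deriv_step: "continuous_on UNIV (deriv step)"
proof -
  have 2: "C_k (Suc (Suc 0)) step" using smooth_step by (simp only: smooth_def)
  have "frechet_derivative step (at t) 1 = deriv step t" for t
    by (simp flip: frechet_derivative_at[OF step_has_derivative[unfolded has_field_derivative_def]])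
  moreover have "continuous_on UNIV (\<lambda>t. frechet_derivative step (at t) 1)"
    using 2 C_k.simps(2)[of "Suc 0" step] C_k_Suc_imp[of 0] C_k.simps(1) by blast
  ultimately show ?thesis by simp
qed

text \<open>Outside the unit interval \<open>step\<close> is locally constant; on it the derivative
  is continuous on a compact set.\<close>

lemma step_derivative_bounded:
  obtains B where "B > 0" "\<And>t. \<bar>deriv step t\<bar> \<le> B" "\<And>t. t < 0 \<or> t > 1 \<Longrightarrow> deriv step t = 0"
proof -
  have "compact (deriv step ` {0..1})"
    by (meson compact_Icc compact_continuous_image continuous_on_deriv_step continuous_on_subset subset_UNIV)
  then have "bounded (deriv step ` {0..1})" by (rule compact_imp_bounded)
  then obtain B where B: "B > 0" "\<And>t. t \<in> {0..1} \<Longrightarrow> \<bar>deriv step t\<bar> \<le> B"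
    by (auto simp only: bounded_pos ball_simps real_norm_def)
  have 0: "deriv step t = 0" if "t < 0 \<or> t > 1" for t
  proof -
    have "(step has_real_derivative 0) (at t)"
      using that
    proof
      assume "t < 0"
      then have "eventually (\<lambda>s. step s = 0) (nhds t)"
        by (intro eventually_mono[OF eventually_nhds_in_open[of "{..<0}" t]]) (auto intro: step_eq_0)
      from DERIV_cong_ev[OF refl this refl, of 0] show ?thesis by simp
    next
      assume "t > 1"
      then have "eventually (\<lambda>s. step s = 1) (nhds t)"
        by (intro eventually_mono[OF eventually_nhds_in_open[of "{1<..}" t]]) (auto intro: step_eq_1)
      from DERIV_cong_ev[OF refl this refl, of 0] show ?thesis by simp
    qed
    then show ?thesis using DERIV_unique[OF step_has_derivative] by blast
  qed
  show ?thesis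
  proof (rule that[OF B(1) _ 0])
    show "\<bar>deriv step t\<bar> \<le> B" for t
      using B(1) B(2)[of t] 0[of t] by (cases "t < 0 \<or> t > 1") (simp, simp add: not_less)
  qed
qed

section \<open>The Hardy-Littlewood-Sobolev inequality\<close>

text \<open>The common majorant of the development. Its power 4/3 is r^(-4/3) near 0 and r^(-8/3) at
  infinity, so it is integrable in the plane and \<open>decay\<close> pairs with L^4
  functions.\<close>

definition decay :: "real \<Rightarrow> real" where
  "decay r = min (1 / r) (1 / r\<^sup>2)"

text \<open>The exponents lie on either side of -1: the first is integrable at 0, the second at
  infinity. Each half line contributes 3 + 3.\<close>

lemma nn_integral_powr_min_finite:
  "(\<integral>\<^sup>+t. ennreal (min (\<bar>t\<bar> powr (-2/3)) (\<bar>t\<bar> powr (-4/3))) \<partial>lborel) < \<infinity>"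
proof -
  let ?p = "\<lambda>t::real. indicator {0..1} t * t powr (-2/3) + indicator {1..} t * t powr (-4/3)"
  have a: "((\<lambda>t::real. if t \<in> {0..1} then t powr (-2/3) else 0) has_integral (1 powr (1/3) / (1/3))) UNIV"
    unfolding has_integral_restrict_UNIV using has_integral_powr_from_0[of "-2/3" 1] by simp
  have b: "((\<lambda>t::real. if t \<in> {1..} then t powr (-4/3) else 0) has_integral (- (1 powr (-1/3)) / (-1/3))) UNIV"
    unfolding has_integral_restrict_UNIV using has_integral_powr_to_inf[of "-4/3" 1] by simp
  have "((\<lambda>t::real. (if t \<in> {0..1} then t powr (-2/3) else 0) + (if t \<in> {1..} then t powr (-4/3) else 0))
      has_integral (3 + 3)) UNIV"
    using has_integral_add[OF a b] by simp
  moreover have "(\<lambda>t::real. (if t \<in> {0..1} then t powr (-2/3) else 0) + (if t \<in> {1..} then t powr (-4/3) else 0)) = ?p"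
    by (auto simp: indicator_def)
  ultimately have "(?p has_integral (3 + 3)) UNIV" by simp
  then have p: "(\<integral>\<^sup>+t. ennreal (?p t) \<partial>lborel) = ennreal (3 + 3)"
    by (intro nn_integral_has_integral_lborel) (auto simp: indicator_def)
  have "(\<integral>\<^sup>+t. ennreal (min (\<bar>t\<bar> powr (-2/3)) (\<bar>t\<bar> powr (-4/3))) \<partial>lborel)
      \<le> (\<integral>\<^sup>+t. ennreal (?p t) + ennreal (?p (- t)) \<partial>lborel)"
    by (intro nn_integral_mono)
      (auto simp: indicator_def min_def simp flip: ennreal_plus intro!: ennreal_leI)
  also have "\<dots> = (\<integral>\<^sup>+t. ennreal (?p t) \<partial>lborel) + (\<integral>\<^sup>+t. ennreal (?p (- t)) \<partial>lborel)"
    by (intro nn_integral_add) auto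
  also have "(\<integral>\<^sup>+t. ennreal (?p (- t)) \<partial>lborel) = (\<integral>\<^sup>+t. ennreal (?p t) \<partial>lborel)"
    using nn_integral_real_affine[of "\<lambda>t. ennreal (?p t)" "-1" 0] by simp
  also have "(\<integral>\<^sup>+t. ennreal (?p t) \<partial>lborel) + (\<integral>\<^sup>+t. ennreal (?p t) \<partial>lborel) < \<infinity>"
    unfolding p by simp
  finally show ?thesis .
qed

lemma Basis_real2: "(Basis :: (real^2) set) = {axis 1 1, axis 2 1}"
  by (auto simp: Basis_vec_def UNIV_2)

lemma axis_1_neq_2: "axis 1 (1::real) \<noteq> (axis 2 1 :: real^2)"
  by (simp add: axis_eq_axis)

lemma decay_nonneg: "r \<ge> 0 \<Longrightarrow> decay r \<ge> 0"
  by (simp add: decay_def)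

lemma decay_powr:
  assumes "r > 0"
  shows "decay r powr (4/3) = min (r powr (-4/3)) (r powr (-8/3))"
proof -
  have "(1 / r) powr (4/3) = r powr (-4/3)" "(1 / r\<^sup>2) powr (4/3) = r powr (-8/3)"
  proof -
    have "1 / r = r powr (-1)" "1 / r\<^sup>2 = r powr (-2)"
      using assms by (simp_all add: powr_minus_divide powr_numeral)
    then show "(1 / r) powr (4/3) = r powr (-4/3)" "(1 / r\<^sup>2) powr (4/3) = r powr (-8/3)"
      by (simp_all only: powr_powr) simp_all
  qed
  moreover have "min a b powr (4/3) = min (a powr (4/3)) (b powr (4/3))" if "a \<ge> 0" "b \<ge> 0" for a b :: real
    using that powr_mono2[of "4/3" a b] powr_mono2[of "4/3" b a] by (auto simp: min_def)
  ultimately show ?thesis using assms by (simp add: decay_def)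
qed

text \<open>A product majorant reduces the plane integral to one-dimensional ones, without polar
  coordinates. For \<open>s\<close> and \<open>t\<close> between -4/3 and -2/3 the sum
  \<open>s + t\<close> lies between -8/3 and -4/3, so r^(s+t) dominates the minimum, and negative
  powers increase when r is replaced by a coordinate.\<close>

lemma decay_powr_le:
  fixes x :: "real^2"
  assumes "x $ 1 \<noteq> 0" "x $ 2 \<noteq> 0"
  shows "decay (norm x) powr (4/3) \<le>
    min (\<bar>x$1\<bar> powr (-2/3)) (\<bar>x$1\<bar> powr (-4/3)) * min (\<bar>x$2\<bar> powr (-2/3)) (\<bar>x$2\<bar> powr (-4/3))"
proof -
  define r where "r = norm x"
  have r: "r > 0" using assms by (auto simp: r_def)
  have le: "\<bar>x$1\<bar> \<le> r" "\<bar>x$2\<bar> \<le> r" using component_le_norm_cart[of x] by (auto simp: r_def)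
  have *: "decay r powr (4/3) \<le> \<bar>x$1\<bar> powr s * \<bar>x$2\<bar> powr t"
    if "-4/3 \<le> s" "s \<le> -2/3" "-4/3 \<le> t" "t \<le> -2/3" for s t
  proof -
    have "decay r powr (4/3) \<le> r powr (s + t)"
    proof (cases "r \<le> 1")
      case True
      then have "r powr (-4/3) \<le> r powr (s + t)"
        using that r by (intro powr_mono') auto
      then show ?thesis by (simp add: decay_powr[OF r])
    next
      case False
      then have "r powr (-8/3) \<le> r powr (s + t)"
        using that r by (intro powr_mono) auto
      then show ?thesis by (simp add: decay_powr[OF r])
    qed
    also have "\<dots> = r powr s * r powr t" by (rule powr_add)
    also have "\<dots> \<le> \<bar>x$1\<bar> powr s * \<bar>x$2\<bar> powr t"
      using that le assms by (intro mult_mono powr_mono2') auto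
    finally show ?thesis .
  qed
  show ?thesis unfolding r_def[symmetric] by (auto simp: min_def intro!: *)
qed

lemma AE_coordinate_nonzero: "AE x::real^2 in lborel. x $ i \<noteq> 0"
proof -
  have "negligible {x::real^2. x \<bullet> axis i 1 = 0}"
    by (rule negligible_standard_hyperplane) (simp add: axis_in_Basis_iff)
  then have "AE x::real^2 in lebesgue. x $ i \<noteq> 0"
    by (intro AE_I'[of "{x. x $ i = 0}"]) (auto simp: negligible_iff_null_sets inner_axis)
  then show ?thesis by (simp add: AE_completion_iff)
qed

lemma nn_integral_decay_finite:
  "(\<integral>\<^sup>+x. ennreal (decay (norm x) powr (4/3)) \<partial>(lborel :: plane measure)) < \<infinity>"
proof -
  let ?m = "\<lambda>t::real. min (\<bar>t\<bar> powr (-2/3)) (\<bar>t\<bar> powr (-4/3))"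
  have "AE x::real^2 in lborel. x $ 1 \<noteq> 0 \<and> x $ 2 \<noteq> 0"
    using AE_coordinate_nonzero[of 1] AE_coordinate_nonzero[of 2] by eventually_elim simp
  then have "(\<integral>\<^sup>+x. ennreal (decay (norm x) powr (4/3)) \<partial>(lborel :: plane measure))
      \<le> (\<integral>\<^sup>+x. (\<Prod>b\<in>Basis. ennreal (?m (x \<bullet> b))) \<partial>(lborel :: plane measure))"
  proof (intro nn_integral_mono_AE, eventually_elim)
    case (elim x)
    then show ?case
      using decay_powr_le[of x] by (simp add: Basis_real2 axis_1_neq_2 inner_axis ennreal_leI flip: ennreal_mult)
  qed
  also have "\<dots> = (\<Prod>b\<in>(Basis::(real^2) set). (\<integral>\<^sup>+t. ennreal (?m t) \<partial>lborel))"
    by (subst nn_integral_lborel_prod) auto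
  also have "\<dots> < \<infinity>"
    using nn_integral_powr_min_finite by (simp add: Basis_real2 axis_1_neq_2 ennreal_mult_less_top)
  finally show ?thesis .
qed

lemma decay_measurable [measurable]: "decay \<in> borel_measurable borel"
  unfolding decay_def[abs_def] by measurable

text \<open>The only non-explicit ingredient of the Hardy-Littlewood-Sobolev constant, which will be
  1 + 2 \<open>decay_const\<close>.\<close>

definition decay_const :: real where
  "decay_const = (LINT x|lborel. decay (norm (x::real^2)) powr (4/3))"

lemma integrable_decay: "integrable lborel (\<lambda>x::real^2. decay (norm x) powr (4/3))"
  using nn_integral_decay_finite by (intro integrableI_bounded) auto

lemma decay_const_nonneg: "decay_const \<ge> 0"
  by (simp add: decay_const_def)

lemma nn_integral_decay_const:
  "(\<integral>\<^sup>+x. ennreal (decay (norm x) powr (4/3)) \<partial>(lborel :: plane measure)) = ennreal decay_const"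
  unfolding decay_const_def by (intro nn_integral_eq_integral integrable_decay) simp

section \<open>The bilinear form with kernel 1/|x - y|, by splitting pairs of points\<close>

lemma nn_integral_plane_affine:
  fixes f :: "real^2 \<Rightarrow> ennreal"
  assumes [measurable]: "f \<in> borel_measurable borel" and c: "c \<noteq> 0"
  shows "(\<integral>\<^sup>+x. f x \<partial>lborel) = ennreal (c\<^sup>2) * (\<integral>\<^sup>+x. f (t + c *\<^sub>R x) \<partial>lborel)"
  by (subst lborel_affine[OF c, of t])
     (simp add: nn_integral_density nn_integral_distr nn_integral_cmult flip: ennreal_power)

text \<open>Bounds a b / r for pairs with b <= a and r^3 a b < 1 in terms of the larger value
  \<open>a\<close> alone, so the variable carried by the other factor can be integrated out freely.
  The two terms cross at r = a^(-2/3), the natural length scale.\<close>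

definition near_part :: "real \<Rightarrow> real \<Rightarrow> real" where
  "near_part a r = min (a\<^sup>2 / r) (1 / r ^ 4)"

lemma near_part_measurable [measurable]: "near_part a \<in> borel_measurable borel"
  unfolding near_part_def[abs_def] by measurable

text \<open>If \<open>r\<^sup>3 a b \<ge> 1\<close> then \<open>1 / r \<le> (a b)\<^sup>1\<^sup>/\<^sup>3\<close>; otherwise \<open>a b / r\<close> is at most
  \<open>1 / r\<^sup>4\<close> and at most \<open>max a b\<^sup>2 / r\<close>.\<close>

lemma kernel_splitting:
  assumes "a \<ge> 0" "b \<ge> 0" "r > 0"
  shows "a * b / r \<le> a powr (4/3) * b powr (4/3) + near_part a r + near_part b r"
proof -
  have nn: "near_part a r \<ge> 0" "near_part b r \<ge> 0" using assms by (auto simp: near_part_def)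
  show ?thesis
  proof (cases "r ^ 3 * (a * b) \<ge> 1")
    case True
    then have "a * b > 0" using assms by (metis mult_nonneg_nonneg less_eq_real_def mult_zero_right not_one_le_zero)
    have "(1 / r) = ((1 / r) ^ 3) powr (1/3)"
    proof -
      have "(1 / r) ^ 3 = (1 / r) powr 3" using assms powr_numeral[of "1 / r" "num.Bit1 num.One"] by simp
      then show ?thesis using assms by (simp only: powr_powr) simp
    qed
    also have "\<dots> \<le> (a * b) powr (1/3)"
      using assms True by (intro powr_mono2) (auto simp: field_simps)
    finally have "a * b * (1 / r) \<le> a * b * (a * b) powr (1/3)"
      using \<open>a * b > 0\<close> by (intro mult_left_mono) auto
    also have "\<dots> = (a * b) powr (4/3)"
      using \<open>a * b > 0\<close> powr_add[of "a * b" 1 "1/3"] by simp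
    also have "\<dots> = a powr (4/3) * b powr (4/3)"
      using assms by (simp add: powr_mult)
    finally show ?thesis using nn by simp
  next
    case False
    have *: "a * b / r \<le> near_part a r" if "b \<le> a" "a \<ge> 0" "r ^ 3 * (a * b) < 1" for a b
    proof -
      have "a * b / r \<le> a\<^sup>2 / r"
        using that assms by (auto simp: power2_eq_square intro!: divide_right_mono mult_left_mono)
      moreover have "a * b / r \<le> 1 / r ^ 4"
        using that assms by (simp add: field_simps power_numeral_reduce)
      ultimately show ?thesis by (simp add: near_part_def)
    qed
    have "a * b / r \<le> near_part a r \<or> a * b / r \<le> near_part b r"
      using *[of b a] *[of a b] False assms by (cases "b \<le> a") (auto simp: mult.commute)
    moreover have "a powr (4/3) * b powr (4/3) \<ge> 0" by simp
    ultimately show ?thesis using nn by linarith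
  qed
qed

text \<open>At the crossover scale both terms acquire the same factor a^(8/3), leaving min(1/r,
  1/r^4), which lies below both r^(-4/3) and r^(-8/3) on either side of r = 1.\<close>

lemma near_part_scaled:
  assumes "a > 0" "r \<ge> 0"
  shows "near_part a (a powr (-2/3) * r) \<le> a powr (8/3) * decay r powr (4/3)"
proof (cases "r = 0")
  case False
  then have r: "r > 0" using assms by simp
  have "a\<^sup>2 / (a powr (-2/3) * r) = a powr (8/3) * (1 / r)"
    using assms r powr_add[of a 2 "2/3"] by (simp add: powr_minus field_simps)
  moreover have "1 / (a powr (-2/3) * r) ^ 4 = a powr (8/3) * (1 / r ^ 4)"
    using assms r by (simp add: powr_minus field_simps power_mult_distrib powr_power)
  moreover have "min (1 / r) (1 / r ^ 4) \<le> decay r powr (4/3)"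
  proof (cases "r \<le> 1")
    case True
    then show ?thesis
      using powr_mono'[of "-4/3" "-1" r] powr_mono'[of "-8/3" "-1" r] using r by (auto simp: decay_powr powr_minus_divide powr_numeral min_le_iff_disj)
  next
    case False
    then show ?thesis
      using powr_mono[of "-4" "-4/3" r] powr_mono[of "-4" "-8/3" r] using r by (auto simp: decay_powr powr_minus_divide powr_numeral min_le_iff_disj)
  qed
  ultimately have "near_part a (a powr (-2/3) * r) = a powr (8/3) * min (1 / r) (1 / r ^ 4)"
    and le: "min (1 / r) (1 / r ^ 4) \<le> decay r powr (4/3)"
    by (simp_all only: near_part_def min_mult_distrib_left powr_ge_zero if_True)
  then show ?thesis by (simp only: mult_left_mono powr_ge_zero)
qed (simp add: near_part_def decay_def)

text \<open>Rescaling by a^(-2/3) has Jacobian a^(-4/3), which turns the factor a^(8/3) into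
  a^(4/3).\<close>

lemma nn_integral_near_part:
  assumes "a \<ge> 0"
  shows "(\<integral>\<^sup>+y. ennreal (near_part a (norm (x - y))) \<partial>(lborel :: plane measure)) \<le> ennreal (decay_const * a powr (4/3))"
proof (cases "a = 0")
  case True
  then show ?thesis by (simp add: near_part_def)
next
  case False
  then have a: "a > 0" using assms by simp
  define c where "c = a powr (-2/3)"
  have c: "c > 0" using a by (simp add: c_def)
  have "(\<integral>\<^sup>+y. ennreal (near_part a (norm (x - y))) \<partial>(lborel :: plane measure))
      = ennreal (c\<^sup>2) * (\<integral>\<^sup>+y. ennreal (near_part a (norm (c *\<^sub>R y))) \<partial>(lborel :: plane measure))"
    using c by (subst nn_integral_plane_affine[where c=c and t=x]) auto
  also have "(\<integral>\<^sup>+y. ennreal (near_part a (norm (c *\<^sub>R y))) \<partial>(lborel :: plane measure))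
      \<le> (\<integral>\<^sup>+y. ennreal (a powr (8/3)) * ennreal (decay (norm y) powr (4/3)) \<partial>(lborel :: plane measure))"
    using near_part_scaled[OF a] c
    by (intro nn_integral_mono) (auto simp: c_def simp flip: ennreal_mult intro!: ennreal_leI)
  also have "\<dots> = ennreal (a powr (8/3)) * ennreal decay_const"
    by (simp add: nn_integral_cmult nn_integral_decay_const)
  also have "ennreal (c\<^sup>2) * (ennreal (a powr (8/3)) * ennreal decay_const)
      = ennreal (c\<^sup>2 * (a powr (8/3) * decay_const))"
    using decay_const_nonneg by (simp add: ennreal_mult)
  also have "c\<^sup>2 * (a powr (8/3) * decay_const) = decay_const * a powr (4/3)"
    using a by (simp add: c_def powr_power flip: powr_add mult.assoc)
  finally show ?thesis by (simp add: mult_left_mono)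
qed

text \<open>In the splitting the product term integrates to the product of the two hypotheses, and
  each near part, integrated first in the variable it does not carry, gives
  \<open>decay_const\<close> times one hypothesis.\<close>

lemma Hardy_Littlewood_Sobolev_sum:
  fixes f g :: "real^2 \<Rightarrow> real"
  assumes [measurable]: "f \<in> borel_measurable borel" "g \<in> borel_measurable borel"
    and nonneg: "\<And>x. f x \<ge> 0" "\<And>x. g x \<ge> 0"
    and F: "(\<integral>\<^sup>+x. ennreal (f x powr (4/3)) \<partial>lborel) \<le> 1"
    and G: "(\<integral>\<^sup>+x. ennreal (g x powr (4/3)) \<partial>lborel) \<le> 1"
  shows "(\<integral>\<^sup>+x. \<integral>\<^sup>+y. ennreal (f x * g y / norm (x - y)) \<partial>lborel \<partial>lborel) \<le> ennreal (1 + 2 * decay_const)"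
proof -
  let ?p = "\<lambda>f x. ennreal (f x powr (4/3))"
  let ?n = "\<lambda>f x y. ennreal (near_part (f x) (norm (x - y)))"
  have [measurable]: "(\<lambda>(x, y). near_part (h x) (norm (x - y))) \<in> borel_measurable (borel \<Otimes>\<^sub>M borel)"
    "(\<lambda>(y, x). near_part (h x) (norm (x - y))) \<in> borel_measurable (borel \<Otimes>\<^sub>M borel)"
    if [measurable]: "h \<in> borel_measurable borel" for h :: "real^2 \<Rightarrow> real"
    unfolding near_part_def by measurable
  have near: "(\<integral>\<^sup>+x. \<integral>\<^sup>+y. ?n h x y \<partial>lborel \<partial>lborel) \<le> ennreal decay_const"
    if [measurable]: "h \<in> borel_measurable borel" and "\<And>x. h x \<ge> 0"
      and H: "(\<integral>\<^sup>+x. ?p h x \<partial>lborel) \<le> 1" for h :: "real^2 \<Rightarrow> real"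
  proof -
    have "(\<integral>\<^sup>+x. \<integral>\<^sup>+y. ?n h x y \<partial>lborel \<partial>lborel) \<le> (\<integral>\<^sup>+x. ennreal decay_const * ?p h x \<partial>lborel)"
      using nn_integral_near_part that decay_const_nonneg
      by (intro nn_integral_mono) (auto simp flip: ennreal_mult)
    also have "\<dots> \<le> ennreal decay_const * 1"
      using mult_left_mono[OF H, of "ennreal decay_const"] by (simp add: nn_integral_cmult)
    finally show ?thesis by simp
  qed
  have "(\<integral>\<^sup>+x. \<integral>\<^sup>+y. ennreal (f x * g y / norm (x - y)) \<partial>lborel \<partial>lborel)
      \<le> (\<integral>\<^sup>+x. \<integral>\<^sup>+y. ?p f x * ?p g y + ?n f x y + ?n g y x \<partial>lborel \<partial>lborel)"
  proof (intro nn_integral_mono)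
    fix x y
    show "ennreal (f x * g y / norm (x - y)) \<le> ?p f x * ?p g y + ?n f x y + ?n g y x"
    proof (cases "x = y")
      case False
      have nn: "near_part a (norm (x - y)) \<ge> 0" if "a \<ge> 0" for a
        using that by (simp add: near_part_def)
      have "ennreal (f x * g y / norm (x - y)) \<le> ennreal (f x powr (4/3) * g y powr (4/3)
          + near_part (f x) (norm (x - y)) + near_part (g y) (norm (x - y)))"
        using False by (intro ennreal_leI kernel_splitting nonneg) auto
      also have "\<dots> = ?p f x * ?p g y + ?n f x y + ?n g y x"
        using nn nonneg by (simp add: ennreal_mult ennreal_plus norm_minus_commute)
      finally show ?thesis .
    qed simp
  qed
  also have "\<dots> = (\<integral>\<^sup>+x. ?p f x \<partial>lborel) * (\<integral>\<^sup>+y. ?p g y \<partial>lborel) + (\<integral>\<^sup>+x. \<integral>\<^sup>+y. ?n f x y \<partial>lborel \<partial>lborel)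
      + (\<integral>\<^sup>+x. \<integral>\<^sup>+y. ?n g y x \<partial>lborel \<partial>lborel)"
    by (simp add: nn_integral_add nn_integral_cmult nn_integral_multc)
  \<comment> \<open>The near part of \<open>g\<close> depends on the value at y, so x has to become
    the inner variable.\<close>
  also have "(\<integral>\<^sup>+x. \<integral>\<^sup>+y. ?n g y x \<partial>lborel \<partial>lborel) = (\<integral>\<^sup>+y. \<integral>\<^sup>+x. ?n g y x \<partial>lborel \<partial>lborel)"
    by (rule lborel_pair.Fubini') measurable
  also have "(\<integral>\<^sup>+x. ?p f x \<partial>lborel) * (\<integral>\<^sup>+y. ?p g y \<partial>lborel) + (\<integral>\<^sup>+x. \<integral>\<^sup>+y. ?n f x y \<partial>lborel \<partial>lborel)
      + (\<integral>\<^sup>+y. \<integral>\<^sup>+x. ?n g y x \<partial>lborel \<partial>lborel) \<le> 1 * 1 + ennreal decay_const + ennreal decay_const"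
    by (intro add_mono mult_mono F G near nonneg) auto
  also have "\<dots> = ennreal (1 + 2 * decay_const)"
  proof -
    have "1 + 2 * decay_const = 1 + decay_const + decay_const" by simp
    then show ?thesis
      using decay_const_nonneg by (simp only: ennreal_plus add_nonneg_nonneg zero_le_one ennreal_1 mult_1)
  qed
  finally show ?thesis .
qed

text \<open>The dual form of the bound from L^(4/3) to L^4. The pointwise splitting is not
  homogeneous, so it is applied to normalised functions and homogeneity is restored by
  scaling.\<close>

lemma Hardy_Littlewood_Sobolev:
  fixes f g :: "real^2 \<Rightarrow> real"
  assumes [measurable]: "f \<in> borel_measurable borel" "g \<in> borel_measurable borel"
    and nonneg: "\<And>x. f x \<ge> 0" "\<And>x. g x \<ge> 0"
    and pos: "A > 0" "B > 0"
    and F: "(\<integral>\<^sup>+x. ennreal (f x powr (4/3)) \<partial>lborel) \<le> ennreal A"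
    and G: "(\<integral>\<^sup>+x. ennreal (g x powr (4/3)) \<partial>lborel) \<le> ennreal B"
  shows "(\<integral>\<^sup>+x. \<integral>\<^sup>+y. ennreal (f x * g y / norm (x - y)) \<partial>lborel \<partial>lborel)
    \<le> ennreal ((1 + 2 * decay_const) * (A powr (3/4) * B powr (3/4)))"
proof -
  define s where "s = A powr (-3/4)"
  define t where "t = B powr (-3/4)"
  have norm1: "(\<integral>\<^sup>+x. ennreal ((D powr (-3/4) * h x) powr (4/3)) \<partial>lborel) \<le> 1"
    if [measurable]: "h \<in> borel_measurable borel" and "\<And>x. h x \<ge> 0" "D > 0"
      "(\<integral>\<^sup>+x. ennreal (h x powr (4/3)) \<partial>lborel) \<le> ennreal D" for h :: "real^2 \<Rightarrow> real" and D
  proof -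
    have "(\<integral>\<^sup>+x. ennreal ((D powr (-3/4) * h x) powr (4/3)) \<partial>lborel)
        = ennreal (1 / D) * (\<integral>\<^sup>+x. ennreal (h x powr (4/3)) \<partial>lborel)"
    proof -
      have "(D powr (-3/4) * y) powr (4/3) = 1 / D * y powr (4/3)" if "y \<ge> 0" for y
      proof -
        have "(D powr (-3/4) * y) powr (4/3) = D powr (-1) * y powr (4/3)"
          using that by (simp only: powr_mult powr_ge_zero powr_powr) simp
        then show ?thesis using \<open>D > 0\<close> by (simp add: powr_minus_divide)
      qed
      then have "ennreal ((D powr (-3/4) * h x) powr (4/3)) = ennreal (1 / D) * ennreal (h x powr (4/3))" for x
        using that by (simp only: ennreal_mult' zero_le_divide_1_iff less_imp_le)
      then show ?thesis by (simp only:) (simp add: nn_integral_cmult)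
    qed
    also have "\<dots> \<le> ennreal (1 / D) * ennreal D"
      by (intro mult_left_mono that) simp
    also have "\<dots> = 1" using that by (simp flip: ennreal_mult)
    finally show ?thesis .
  qed
  have st: "s > 0" "t > 0" using pos by (auto simp: s_def t_def)
  have *: "(\<integral>\<^sup>+x. \<integral>\<^sup>+y. ennreal ((s * f x) * (t * g y) / norm (x - y)) \<partial>lborel \<partial>lborel) \<le> ennreal (1 + 2 * decay_const)"
    unfolding s_def t_def
    by (rule Hardy_Littlewood_Sobolev_sum) (use norm1 F G pos nonneg in auto)
  have "(\<integral>\<^sup>+x. \<integral>\<^sup>+y. ennreal (f x * g y / norm (x - y)) \<partial>lborel \<partial>lborel)
     = (\<integral>\<^sup>+x. \<integral>\<^sup>+y. ennreal (1 / (s * t)) * ennreal ((s * f x) * (t * g y) / norm (x - y)) \<partial>lborel \<partial>lborel)"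
    using st nonneg by (simp flip: ennreal_mult)
  also have "\<dots> = ennreal (1 / (s * t)) * (\<integral>\<^sup>+x. \<integral>\<^sup>+y. ennreal ((s * f x) * (t * g y) / norm (x - y)) \<partial>lborel \<partial>lborel)"
    by (simp add: nn_integral_cmult)
  also have "\<dots> \<le> ennreal (1 / (s * t)) * ennreal (1 + 2 * decay_const)"
    by (intro mult_left_mono *) simp
  also have "\<dots> = ennreal ((1 + 2 * decay_const) * (A powr (3/4) * B powr (3/4)))"
  proof -
    have "1 / (s * t) = A powr (3/4) * B powr (3/4)"
      by (simp add: s_def t_def powr_minus_divide)
    then show ?thesis
      using decay_const_nonneg by (simp only: mult.commute[of "ennreal (A powr (3/4) * B powr (3/4))"])
        (subst ennreal_mult[symmetric], auto)
  qed
  finally show ?thesis .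
qed

section \<open>Clifford multiplication\<close>

lemma clifford_square: "clifford e \<Longrightarrow> e i ** e i = mat (- 1)"
proof -
  assume "clifford e"
  then have "e i ** e i + e i ** e i = mat (- 2)" by (simp add: clifford_def)
  from arg_cong[OF this, of "\<lambda>A. A $ k $ l" for k l]
  have "(e i ** e i) $ k $ l + (e i ** e i) $ k $ l = mat (- 1) $ k $ l + mat (- 1) $ k $ l" for k l
    by (simp add: mat_def)
  moreover have "z + z = w + w \<Longrightarrow> z = w" for z w :: complex
    by (simp add: complex_eq_iff)
  ultimately show ?thesis by (simp add: vec_eq_iff)
qed

lemma matrix_vector_neg_id: "mat (- 1) *v (w :: complex^'n) = - w"
  by (simp add: vec_eq_iff matrix_vector_mult_def mat_def if_distrib[of "\<lambda>c. c * _"] cong: if_cong)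

lemma clifford_mult_self: "clifford e \<Longrightarrow> e i *v (e i *v w) = - w"
  by (simp add: matrix_vector_mul_assoc clifford_square matrix_vector_neg_id)

lemma clifford_anticommute:
  assumes "clifford e"
  shows "e 1 *v (e 2 *v w) + e 2 *v (e 1 *v w) = 0"
proof -
  have "e 1 ** e 2 + e 2 ** e 1 = mat 0" using assms by (simp add: clifford_def)
  then show ?thesis
    by (simp add: matrix_vector_mul_assoc flip: matrix_vector_mult_add_rdistrib)
qed

text \<open>The algebra behind D^2 = -\<Delta>: the off-diagonal terms cancel by anticommutation and
  the diagonal ones use squares equal to -1. \<open>A i k\<close> will be the integral of a second
  derivative times \<psi>, hence the symmetry.\<close>

lemma clifford_laplace:
  assumes e: "clifford e" and sym: "A 1 2 = A 2 1"
  shows "(\<Sum>k\<in>UNIV. e k *v (\<Sum>i\<in>UNIV. e i *v A i k)) = - (A 1 1 + A 2 2)"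
  using clifford_anticommute[OF e, of "A 1 2"] clifford_mult_self[OF e] sym
  by (simp add: sum_2 matrix_vector_right_distrib algebra_simps)

lemma norm_matrix_vector_le:
  fixes A :: "complex^2^2"
  assumes "\<And>i j. cmod (A $ i $ j) \<le> 1"
  shows "norm (A *v w) \<le> 4 * norm w"
proof -
  have "cmod ((A *v w) $ i) \<le> 2 * norm w" for i
  proof -
    have "cmod ((A *v w) $ i) \<le> (\<Sum>j\<in>UNIV. cmod (A $ i $ j * w $ j))"
      unfolding matrix_vector_mult_def by (simp add: norm_sum)
    also have "\<dots> \<le> (\<Sum>j\<in>(UNIV::2 set). 1 * norm w)"
      unfolding norm_mult by (intro sum_mono mult_mono assms Finite_Cartesian_Product.norm_nth_le) auto
    finally show ?thesis by simp
  qed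
  then have "(\<Sum>i\<in>UNIV. cmod ((A *v w) $ i)) \<le> (\<Sum>i\<in>(UNIV::2 set). 2 * norm w)"
    by (intro sum_mono)
  then show ?thesis
    using L2_set_le_sum[of UNIV "\<lambda>i. cmod ((A *v w) $ i)"] by (simp add: norm_vec_def[of "A *v w"])
qed

text \<open>A skew-Hermitian matrix with square -1 is unitary, so its rows are unit vectors. This
  makes the later constants independent of \<open>e\<close>.\<close>

lemma clifford_entry_le_1:
  assumes "clifford e"
  shows "cmod (e i $ k $ l) \<le> 1"
proof -
  have skew: "cnj (e i $ k $ l) = - e i $ l $ k" for k l
    using assms by (simp add: clifford_def skew_hermitian_def)
  have "(e i ** e i) $ k $ k = - 1"
    using clifford_square[OF assms] by (simp add: mat_def)
  then have "(\<Sum>l\<in>UNIV. e i $ k $ l * e i $ l $ k) = - 1"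
    by (simp add: matrix_matrix_mult_def)
  moreover have "e i $ k $ l * e i $ l $ k = - complex_of_real ((cmod (e i $ k $ l))\<^sup>2)" for l
  proof -
    have "e i $ l $ k = - cnj (e i $ k $ l)" using skew[of k l] by simp
    then show ?thesis by (simp only: complex_norm_square mult_minus_right)
  qed
  ultimately have "- complex_of_real (\<Sum>l\<in>UNIV. (cmod (e i $ k $ l))\<^sup>2) = - 1"
    by (simp add: sum_negf)
  then have "(\<Sum>l\<in>UNIV. (cmod (e i $ k $ l))\<^sup>2) = 1"
    by (metis neg_equal_iff_equal of_real_eq_1_iff)
  moreover have "(cmod (e i $ k $ l))\<^sup>2 \<le> (\<Sum>l\<in>UNIV. (cmod (e i $ k $ l))\<^sup>2)"
    by (rule member_le_sum) auto
  ultimately show ?thesis by (simp add: power_le_one_iff abs_square_le_1)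
qed

lemma norm_clifford_mult_le: "clifford e \<Longrightarrow> norm (e i *v w) \<le> 4 * norm w"
  by (intro norm_matrix_vector_le clifford_entry_le_1)

section \<open>Regularised Green functions and cutoffs\<close>

text \<open>The gradient of \<open>1/2 log (\<bar>x - a\<bar>\<^sup>2 + d\<^sup>2)\<close> and its derivatives; the trace \<open>2 d\<^sup>2 / (\<bar>x - a\<bar>\<^sup>2 + d\<^sup>2)\<^sup>2\<close>
  of the Hessian is an approximate identity, up to a constant factor, as \<open>d\<close> tends to zero.\<close>

definition green_denom :: "plane \<Rightarrow> real \<Rightarrow> plane \<Rightarrow> real" where
  "green_denom a d x = (norm (x - a))\<^sup>2 + d\<^sup>2"

definition green_grad :: "plane \<Rightarrow> real \<Rightarrow> 2 \<Rightarrow> plane \<Rightarrow> real" where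
  "green_grad a d k x = (x $ k - a $ k) * inverse (green_denom a d x)"

definition green_hess :: "plane \<Rightarrow> real \<Rightarrow> 2 \<Rightarrow> 2 \<Rightarrow> plane \<Rightarrow> real" where
  "green_hess a d i k x = (if i = k then 1 else 0) / green_denom a d x
     - 2 * (x $ i - a $ i) * (x $ k - a $ k) / (green_denom a d x)\<^sup>2"

definition bump :: "plane \<Rightarrow> real \<Rightarrow> plane \<Rightarrow> real" where
  "bump a d x = 2 * d\<^sup>2 / (green_denom a d x)\<^sup>2"

lemma norm_plane_sq: "(norm x)\<^sup>2 = (x $ 1)\<^sup>2 + (x $ 2)\<^sup>2" for x :: plane
  by (simp add: norm_vec_def L2_set_def sum_2)

lemma green_denom_pos: "d > 0 \<Longrightarrow> green_denom a d x > 0"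
  by (simp add: green_denom_def add_nonneg_pos)

lemma green_hess_trace:
  assumes "d > 0" shows "green_hess a d 1 1 x + green_hess a d 2 2 x = bump a d x"
proof -
  have "green_denom a d x \<noteq> 0" using green_denom_pos[OF assms, of a x] by simp
  then have "green_hess a d 1 1 x + green_hess a d 2 2 x
      = 2 * (green_denom a d x - ((x - a) $ 1)\<^sup>2 - ((x - a) $ 2)\<^sup>2) / (green_denom a d x)\<^sup>2"
    unfolding green_hess_def by (simp add: divide_simps) (simp add: power2_eq_square algebra_simps)
  also have "green_denom a d x - ((x - a) $ 1)\<^sup>2 - ((x - a) $ 2)\<^sup>2 = d\<^sup>2"
    unfolding green_denom_def norm_plane_sq by simp
  finally show ?thesis by (simp add: bump_def)
qed

lemma green_hess_sym: "green_hess a d i k x = green_hess a d k i x"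
  by (simp add: green_hess_def mult_ac del: left_diff_distrib_numeral right_diff_distrib_numeral)

lemma smooth_green_grad:
  assumes "d > 0" shows "smooth (green_grad a d k)"
proof -
  have "smooth (green_denom a d)"
    unfolding green_denom_def[abs_def] by (intro smooth_add smooth_norm_sq smooth_const)
  moreover have "green_denom a d x \<noteq> 0" for x using green_denom_pos[OF assms, of a x] by simp
  ultimately show ?thesis
    unfolding green_grad_def[abs_def]
    by (intro smooth_mult smooth_diff smooth_inverse smooth_const)
      (auto intro: smooth_linear bounded_linear_vec_nth)
qed

lemma has_derivative_norm_sq:
  "((\<lambda>x::plane. (norm (x - a))\<^sup>2) has_derivative (\<lambda>v. 2 * ((x - a) \<bullet> v))) (at x)"
  unfolding power2_norm_eq_inner
  by (auto intro!: derivative_eq_intros simp: inner_commute)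

lemma has_derivative_green_grad:
  assumes "d > 0"
  shows "(green_grad a d k has_derivative (\<lambda>v. \<Sum>i\<in>UNIV. v $ i * green_hess a d i k x)) (at x)"
proof -
  have nz: "green_denom a d x \<noteq> 0" using green_denom_pos[OF assms, of a x] by simp
  have D: "(green_denom a d has_derivative (\<lambda>v. 2 * ((x - a) \<bullet> v))) (at x)"
    unfolding green_denom_def[abs_def]
    using has_derivative_add[OF has_derivative_norm_sq has_derivative_const] by simp
  have N: "((\<lambda>x::plane. x $ k - a $ k) has_derivative (\<lambda>v. v $ k)) (at x)"
    using has_derivative_diff[OF bounded_linear_imp_has_derivative[OF bounded_linear_vec_nth] has_derivative_const]
    by simp
  have *: "(\<lambda>v. (x $ k - a $ k) * - (inverse (green_denom a d x) * (2 * ((x - a) \<bullet> v)) * inverse (green_denom a d x))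
      + v $ k * inverse (green_denom a d x)) = (\<lambda>v. \<Sum>i\<in>UNIV. v $ i * green_hess a d i k x)"
  proof
    fix v :: plane
    have "(x - a) \<bullet> v = (x $ 1 - a $ 1) * v $ 1 + (x $ 2 - a $ 2) * v $ 2"
      by (simp add: inner_vec_def sum_2)
    moreover have "k = 1 \<or> k = 2" by (rule exhaust_2)
    ultimately show "(x $ k - a $ k) * - (inverse (green_denom a d x) * (2 * ((x - a) \<bullet> v)) * inverse (green_denom a d x))
      + v $ k * inverse (green_denom a d x) = (\<Sum>i\<in>UNIV. v $ i * green_hess a d i k x)"
      using nz by (auto simp: sum_2 green_hess_def divide_simps) (auto simp: power2_eq_square algebra_simps)
  qed
  show ?thesis
    unfolding green_grad_def[abs_def] *[symmetric]
    by (rule has_derivative_mult[OF N Deriv.has_derivative_inverse[OF nz D]])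
qed

text \<open>Centred at the origin rather than at \<open>a\<close>, to match the cutoffs and
  \<open>decay\<close>. The constant depends on \<open>a\<close> and \<open>d\<close>; it serves
  only to justify integrability and limits, never the final estimate.\<close>

lemma green_bounds:
  assumes "d > 0"
  obtains C where "C > 0" "\<And>x k. \<bar>green_grad a d k x\<bar> \<le> C / (1 + norm x)"
    "\<And>x i k. \<bar>green_hess a d i k x\<bar> \<le> C / (1 + norm x)\<^sup>2"
proof -
  \<comment> \<open>From 1 + |x| <= (1 + |a|) + |x - a| and (p + q)^2 <= 2 p^2 + 2 q^2: the first
    square is absorbed by d^2, the second by |x - a|^2.\<close>
  define C where "C = 2 * (1 + norm a)\<^sup>2 / d\<^sup>2 + 2"
  have C: "C \<ge> 2" by (simp add: C_def)
  have le: "(1 + norm x)\<^sup>2 \<le> C * green_denom a d x" for x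
  proof -
    have "norm x \<le> norm a + norm (x - a)" by norm
    then have "(1 + norm x)\<^sup>2 \<le> ((1 + norm a) + norm (x - a))\<^sup>2" by (intro power_mono) auto
    also have "\<dots> \<le> 2 * (1 + norm a)\<^sup>2 + 2 * (norm (x - a))\<^sup>2"
      using sum_squares_bound[of "1 + norm a" "norm (x - a)"] by (simp add: power2_sum)
    also have "\<dots> \<le> C * green_denom a d x"
      using assms by (simp add: C_def green_denom_def distrib_left distrib_right)
    finally show ?thesis .
  qed
  have pos: "green_denom a d x > 0" for x by (rule green_denom_pos[OF assms])
  have comp: "\<bar>x $ k - a $ k\<bar> \<le> norm (x - a)" for x k
    using component_le_norm_cart[of "x - a" k] by simp
  have na: "(norm (x - a))\<^sup>2 \<le> green_denom a d x" for x by (simp add: green_denom_def)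
  show ?thesis
  proof (rule that[of "3 * C"])
    fix x k
    have "\<bar>x $ k - a $ k\<bar> * (1 + norm x) \<le> norm (x - a) * (1 + norm x)"
      using comp by (intro mult_right_mono) auto
    also have "\<dots> \<le> (norm (x - a))\<^sup>2 + (1 + norm x)\<^sup>2"
    proof -
      have "0 \<le> norm (x - a) * (1 + norm x)" by simp
      then show ?thesis using sum_squares_bound[of "norm (x - a)" "1 + norm x"] by linarith
    qed
    also have "\<dots> \<le> (1 + C) * green_denom a d x"
      using le na by (simp add: distrib_right add_mono)
    also have "\<dots> \<le> 3 * C * green_denom a d x"
      using C pos[of x] by (intro mult_right_mono) auto
    finally have "\<bar>x $ k - a $ k\<bar> * (1 + norm x) \<le> 3 * C * green_denom a d x" .
    then show "\<bar>green_grad a d k x\<bar> \<le> 3 * C / (1 + norm x)"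
      using pos[of x] by (simp add: green_grad_def abs_mult field_simps add_pos_nonneg)
  next
    fix x i k
    let ?D = "green_denom a d x"
    have "\<bar>green_hess a d i k x\<bar> \<le> 1 / ?D + 2 * (\<bar>x $ i - a $ i\<bar> * \<bar>x $ k - a $ k\<bar>) / ?D\<^sup>2"
    proof -
      have "\<bar>green_hess a d i k x\<bar> \<le> \<bar>(if i = k then 1 else 0) / ?D\<bar> + \<bar>2 * (x $ i - a $ i) * (x $ k - a $ k) / ?D\<^sup>2\<bar>"
        unfolding green_hess_def by (rule abs_triangle_ineq4)
      also have "\<dots> \<le> 1 / ?D + 2 * (\<bar>x $ i - a $ i\<bar> * \<bar>x $ k - a $ k\<bar>) / ?D\<^sup>2"
        using pos[of x] by (intro add_mono) (auto simp: abs_mult mult.assoc simp del: left_diff_distrib_numeral right_diff_distrib_numeral)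
      finally show ?thesis .
    qed
    also have "\<bar>x $ i - a $ i\<bar> * \<bar>x $ k - a $ k\<bar> \<le> (norm (x - a))\<^sup>2"
      using comp by (simp add: power2_eq_square mult_mono)
    also note na
    finally have "\<bar>green_hess a d i k x\<bar> \<le> 1 / ?D + 2 * ?D / ?D\<^sup>2"
      using pos[of x] by (simp add: divide_right_mono)
    also have "\<dots> = 3 / ?D" using pos[of x] by (simp add: power2_eq_square)
    also have "\<dots> \<le> 3 * C / (1 + norm x)\<^sup>2"
    proof -
      have "1 + norm x > 0" using norm_ge_zero[of x] by linarith
      then have "(1 + norm x)\<^sup>2 > 0" by (rule zero_less_power)
      then show ?thesis using le[of x] pos[of x] by (simp add: field_simps)
    qed
    finally show "\<bar>green_hess a d i k x\<bar> \<le> 3 * C / (1 + norm x)\<^sup>2" .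
  qed (use C in simp)
qed

section \<open>Cutoffs at the origin and at infinity\<close>

lemma decay_ge_square: "r > 0 \<Longrightarrow> 1 / (1 + r)\<^sup>2 \<le> decay r"
  and decay_ge_product: "r > 0 \<Longrightarrow> 1 / (r * (1 + r)) \<le> decay r"
  by (auto simp: decay_def power2_eq_square intro!: divide_left_mono mult_strict_mono mult_pos_pos)
    (auto simp: algebra_simps)

text \<open>Equal to 1 for sqrt 2 / n <= |x| <= n, and 0 for |x| <= 1/n and for |x| >= sqrt 2 n.
  Working with the squared norm keeps it smooth everywhere.\<close>

definition cutoff :: "real \<Rightarrow> plane \<Rightarrow> real" where
  "cutoff n x = step (2 - (norm x)\<^sup>2 / n\<^sup>2) * step (n\<^sup>2 * (norm x)\<^sup>2 - 1)"

text \<open>The cutoff is radial; its gradient is this scalar times x.\<close>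

definition cutoff_deriv :: "real \<Rightarrow> plane \<Rightarrow> real" where
  "cutoff_deriv n x = 2 * (step (2 - (norm x)\<^sup>2 / n\<^sup>2) * (deriv step (n\<^sup>2 * (norm x)\<^sup>2 - 1) * n\<^sup>2)
     - deriv step (2 - (norm x)\<^sup>2 / n\<^sup>2) / n\<^sup>2 * step (n\<^sup>2 * (norm x)\<^sup>2 - 1))"

lemma smooth_cutoff: "smooth (cutoff n)"
proof -
  have "smooth (\<lambda>x::plane. (norm x)\<^sup>2)" using smooth_norm_sq[of 0] by simp
  then have "smooth (\<lambda>x::plane. step (2 - (norm x)\<^sup>2 * (1 / n\<^sup>2)) * step (n\<^sup>2 * (norm x)\<^sup>2 - 1))"
    by (intro smooth_mult smooth_diff smooth_const smooth_compose[OF smooth_step])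
  then show ?thesis by (simp add: cutoff_def[abs_def])
qed

lemma cutoff_bounds: "0 \<le> cutoff n x" "cutoff n x \<le> 1"
  using step_bounds by (auto simp: cutoff_def mult_le_one)

lemma has_derivative_cutoff:
  "(cutoff n has_derivative (\<lambda>v. cutoff_deriv n x * (x \<bullet> v))) (at x)"
proof -
  have N: "((\<lambda>x::plane. (norm x)\<^sup>2) has_derivative (\<lambda>v. 2 * (x \<bullet> v))) (at x)"
    using has_derivative_norm_sq[of 0 x] by simp
  have chain: "((\<lambda>x::plane. step (p + q * (norm x)\<^sup>2)) has_derivative
      (\<lambda>v. deriv step (p + q * (norm x)\<^sup>2) * (q * (2 * (x \<bullet> v))))) (at x)" for p q
  proof (rule has_derivative_compose[where g=step, OF _ step_has_derivative[unfolded has_field_derivative_def]])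
    show "((\<lambda>x::plane. p + q * (norm x)\<^sup>2) has_derivative (\<lambda>v. q * (2 * (x \<bullet> v)))) (at x)"
      using has_derivative_add[OF has_derivative_const has_derivative_mult_right[OF N]] by simp
  qed
  have "((\<lambda>x. step (2 + (- (1 / n\<^sup>2)) * (norm x)\<^sup>2) * step (- 1 + n\<^sup>2 * (norm x)\<^sup>2)) has_derivative
     (\<lambda>v. step (2 + (- (1 / n\<^sup>2)) * (norm x)\<^sup>2) * (deriv step (- 1 + n\<^sup>2 * (norm x)\<^sup>2) * (n\<^sup>2 * (2 * (x \<bullet> v))))
       + deriv step (2 + (- (1 / n\<^sup>2)) * (norm x)\<^sup>2) * (- (1 / n\<^sup>2) * (2 * (x \<bullet> v))) * step (- 1 + n\<^sup>2 * (norm x)\<^sup>2))) (at x)"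
    by (rule has_derivative_mult[OF chain chain])
  then show ?thesis
    by (simp add: cutoff_def[abs_def] cutoff_deriv_def algebra_simps)
qed

text \<open>Both transitions occur at scales comparable to |x|, so the gradient of the cutoff is at
  most B/|x| with B independent of n.\<close>

lemma cutoff_deriv_bounded:
  obtains B where "B > 0" "\<And>n x. n > 0 \<Longrightarrow> \<bar>cutoff_deriv n x\<bar> * (norm x)\<^sup>2 \<le> B"
proof -
  obtain B where B: "B > 0" "\<And>t. \<bar>deriv step t\<bar> \<le> B" "\<And>t. t < 0 \<or> t > 1 \<Longrightarrow> deriv step t = 0"
    by (rule step_derivative_bounded) blast
  \<comment> \<open>\<open>q\<close> is the scaled squared radius. Where the derivative of
    \<open>step\<close> can be nonzero its argument lies in the unit interval, which in both uses
    forces \<open>q\<close> <= 2.\<close>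
  have key: "\<bar>deriv step t\<bar> * q \<le> 2 * B" if "q \<ge> 0" "0 \<le> t \<and> t \<le> 1 \<longrightarrow> q \<le> 2" for t q
  proof (cases "0 \<le> t \<and> t \<le> 1")
    case True
    then have "\<bar>deriv step t\<bar> * q \<le> B * 2" using that B by (intro mult_mono) auto
    then show ?thesis by simp
  qed (use B in auto)
  show ?thesis
  proof (rule that[of "8 * B"])
    fix n :: real and x :: plane assume n: "n > 0"
    let ?q = "(norm x)\<^sup>2"
    let ?s = "step (2 - ?q / n\<^sup>2)" and ?t = "step (n\<^sup>2 * ?q - 1)"
    let ?ds = "deriv step (2 - ?q / n\<^sup>2)" and ?dt = "deriv step (n\<^sup>2 * ?q - 1)"
    have 1: "\<bar>?dt\<bar> * (n\<^sup>2 * ?q) \<le> 2 * B" by (rule key) auto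
    have 2: "\<bar>?ds\<bar> * (?q / n\<^sup>2) \<le> 2 * B" by (rule key) auto
    have "\<bar>cutoff_deriv n x\<bar> * ?q = 2 * \<bar>?s * (?dt * n\<^sup>2) - ?ds / n\<^sup>2 * ?t\<bar> * ?q"
      unfolding cutoff_deriv_def by (simp only: abs_mult abs_numeral)
    also have "\<dots> \<le> 2 * (\<bar>?s * (?dt * n\<^sup>2)\<bar> + \<bar>?ds / n\<^sup>2 * ?t\<bar>) * ?q"
      by (intro mult_right_mono mult_left_mono abs_triangle_ineq4) auto
    also have "\<dots> = 2 * (?s * (\<bar>?dt\<bar> * (n\<^sup>2 * ?q)) + ?t * (\<bar>?ds\<bar> * (?q / n\<^sup>2)))"
      using step_bounds by (simp add: abs_mult algebra_simps)
    also have "\<dots> \<le> 2 * (1 * (2 * B) + 1 * (2 * B))"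
      using step_bounds 1 2 B by (intro mult_left_mono[OF add_mono[OF mult_mono mult_mono]]) auto
    finally show "\<bar>cutoff_deriv n x\<bar> * ?q \<le> 8 * B" by simp
  qed (use B in simp)
qed

lemma cutoff_eventually:
  assumes "x \<noteq> 0"
  shows "\<forall>\<^sub>F m in sequentially. cutoff (real (Suc m)) x = 1 \<and> cutoff_deriv (real (Suc m)) x = 0"
proof -
  obtain B where B: "\<And>t. t < 0 \<or> t > 1 \<Longrightarrow> deriv step t = 0"
    by (rule step_derivative_bounded) blast
  have q: "(norm x)\<^sup>2 > 0" using assms by simp
  obtain N :: nat where N: "real N > max ((norm x)\<^sup>2) (2 / (norm x)\<^sup>2)" using reals_Archimedean2 by blast
  show ?thesis
  proof (rule eventually_sequentiallyI)
    fix m assume m: "N \<le> m"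
    define n where "n = real (Suc m)"
    have n: "n \<ge> 1" "n > (norm x)\<^sup>2" "n > 2 / (norm x)\<^sup>2" using N m by (auto simp: n_def)
    have "n \<le> n\<^sup>2" using n(1) by (simp add: power2_eq_square)
    then have sq: "n\<^sup>2 > (norm x)\<^sup>2" "n\<^sup>2 > 2 / (norm x)\<^sup>2" using n by auto
    have 1: "2 - (norm x)\<^sup>2 / n\<^sup>2 > 1" using sq n by (simp add: field_simps)
    have 2: "n\<^sup>2 * (norm x)\<^sup>2 - 1 > 1" using sq q by (simp add: field_simps)
    show "cutoff (real (Suc m)) x = 1 \<and> cutoff_deriv (real (Suc m)) x = 0"
      unfolding n_def[symmetric] cutoff_def cutoff_deriv_def
      using 1 2 B step_eq_1 by simp
  qed
qed

lemma cutoff_support: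
  assumes "n > 0"
  shows "compact (closure {x. cutoff n x * g x \<noteq> 0})" "closure {x. cutoff n x * g x \<noteq> 0} \<subseteq> UNIV - {0}"
proof -
  let ?A = "{x::plane. (norm x)\<^sup>2 \<le> 2 * n\<^sup>2} \<inter> {x. n\<^sup>2 * (norm x)\<^sup>2 \<ge> 1}"
  have "{x. cutoff n x * g x \<noteq> 0} \<subseteq> ?A"
  proof
    fix x assume "x \<in> {x. cutoff n x * g x \<noteq> 0}"
    then have "\<not> 2 - (norm x)\<^sup>2 / n\<^sup>2 \<le> 0" "\<not> n\<^sup>2 * (norm x)\<^sup>2 - 1 \<le> 0"
      using step_eq_0 by (auto simp: cutoff_def)
    then show "x \<in> ?A" using assms by (simp add: field_simps)
  qed
  moreover have "closed ?A"
    by (intro closed_Int closed_Collect_le continuous_intros)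
  ultimately have sub: "closure {x. cutoff n x * g x \<noteq> 0} \<subseteq> ?A"
    by (rule closure_minimal)
  show "closure {x. cutoff n x * g x \<noteq> 0} \<subseteq> UNIV - {0}"
    using sub by auto
  have "norm x \<le> sqrt (2 * n\<^sup>2)" if "(norm x)\<^sup>2 \<le> 2 * n\<^sup>2" for x :: plane
    using that by (rule real_le_rsqrt)
  then have "bounded (closure {x. cutoff n x * g x \<noteq> 0})"
    using sub by (intro boundedI[of _ "sqrt (2 * n\<^sup>2)"]) auto
  then show "compact (closure {x. cutoff n x * g x \<noteq> 0})"
    by (simp add: compact_eq_bounded_closed)
qed

lemma cutoff_test_function:
  assumes "smooth g" "n > 0"
  shows "(\<lambda>x. cutoff n x * g x) \<in> test_functions (UNIV - {0})"
  using smooth_mult[OF smooth_cutoff assms(1), of n] cutoff_support[OF assms(2), of g]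
  by (simp add: test_functions_def smooth_def)

section \<open>The tested equation\<close>

text \<open>Young's inequality without sharp constants, by comparing t^3 with s. It suffices for
  integrability of products of L^4 and L^(4/3) functions.\<close>

lemma mult_le_power4_add:
  fixes t s :: real
  assumes "t \<ge> 0" "s \<ge> 0"
  shows "t * s \<le> t ^ 4 + s powr (4/3)"
proof (cases "t ^ 3 \<le> s")
  case True
  have "t = (t powr 3) powr (1/3)" using assms by (simp only: powr_powr) simp
  also have "t powr 3 = t ^ 3" using assms powr_numeral[of t "num.Bit1 num.One"] by (cases "t = 0") auto
  finally have "t = (t ^ 3) powr (1/3)" .
  also have "\<dots> \<le> s powr (1/3)" using True assms by (intro powr_mono2) auto
  finally have "t * s \<le> s powr (1/3) * s" using assms by (intro mult_right_mono) auto
  also have "\<dots> = s powr (4/3)" using assms powr_add[of s "1/3" 1] by simp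
  finally show ?thesis using assms by (simp add: add_increasing)
next
  case False
  then have "t * s \<le> t * t ^ 3" using assms by (intro mult_left_mono) auto
  also have "\<dots> = t ^ 4" by (simp add: power_numeral_reduce)
  finally show ?thesis by (simp add: add_increasing2)
qed

lemma green_measurable [measurable]:
  "green_denom a d \<in> borel_measurable borel" "green_grad a d k \<in> borel_measurable borel"
  "green_hess a d i k \<in> borel_measurable borel" "bump a d \<in> borel_measurable borel"
  unfolding green_denom_def[abs_def] green_grad_def[abs_def] green_hess_def[abs_def] bump_def[abs_def]
  by measurable

text \<open>The problem for Borel representatives. \<open>V\<close> agrees with e^u only almost
  everywhere and need not be nonnegative, hence absolute values below. The minus sign of the
  distributional derivative has been cancelled against the one in the equation.\<close>

locale dirac_solution =
  fixes e :: "2 \<Rightarrow> complex^2^2" and \<psi> :: "plane \<Rightarrow> spinor" and V :: "plane \<Rightarrow> real"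
  assumes clifford: "clifford e"
    and \<psi>_measurable [measurable]: "\<psi> \<in> borel_measurable borel"
    and V_measurable [measurable]: "V \<in> borel_measurable borel"
    and integrable_\<psi>: "integrable lborel (\<lambda>x. norm (\<psi> x) ^ 4)"
    and integrable_V: "integrable lborel (\<lambda>x. (V x)\<^sup>2)"
    and equation: "\<And>\<phi>. \<phi> \<in> test_functions (UNIV - {0}) \<Longrightarrow>
      (\<Sum>i\<in>UNIV. e i *v (LINT x|lborel. frechet_derivative \<phi> (at x) (axis i 1) *\<^sub>R \<psi> x))
        = (LINT x|lborel. \<phi> x *\<^sub>R V x *\<^sub>R \<psi> x)"
begin

lemma integrable_decay_\<psi>: "integrable lborel (\<lambda>x. norm (\<psi> x) * decay (norm x))"
proof (rule Bochner_Integration.integrable_bound)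
  show "integrable lborel (\<lambda>x. norm (\<psi> x) ^ 4 + decay (norm x) powr (4/3))"
    by (intro Bochner_Integration.integrable_add integrable_\<psi> integrable_decay)
  show "AE x in lborel. norm (norm (\<psi> x) * decay (norm x)) \<le> norm (norm (\<psi> x) ^ 4 + decay (norm x) powr (4/3))"
    using mult_le_power4_add[of "norm (\<psi> x)" "decay (norm x)" for x] by (auto simp: decay_nonneg)
qed measurable

text \<open>Hoelder with exponents 2, 4, 4, done pointwise by using p q <= p^2 + q^2 twice. The
  remaining (1 + |x|)^(-4) is below the power 4/3 of \<open>decay\<close>.\<close>

lemma integrable_V_\<psi>: "integrable lborel (\<lambda>x. \<bar>V x\<bar> * norm (\<psi> x) / (1 + norm x))"
proof (rule Bochner_Integration.integrable_bound)
  let ?b = "\<lambda>x. (V x)\<^sup>2 + (norm (\<psi> x) ^ 4 + decay (norm x) powr (4/3))"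
  show "integrable lborel ?b"
    by (intro Bochner_Integration.integrable_add integrable_V integrable_\<psi> integrable_decay)
  have "AE x::plane in lborel. x \<noteq> 0" by (rule AE_lborel_singleton)
  then show "AE x in lborel. norm (\<bar>V x\<bar> * norm (\<psi> x) / (1 + norm x)) \<le> norm (?b x)"
  proof eventually_elim
    case (elim x)
    define r where "r = 1 / (1 + norm x)"
    have r: "0 \<le> r" "r \<le> 1" by (auto simp: r_def divide_simps add_nonneg_pos add_pos_nonneg)
    have sq: "p * q \<le> p\<^sup>2 + q\<^sup>2" if "p \<ge> 0" "q \<ge> 0" for p q :: real
      using sum_squares_bound[of p q] mult_nonneg_nonneg[OF that] by linarith
    have "\<bar>V x\<bar> * (norm (\<psi> x) * r) \<le> (V x)\<^sup>2 + (norm (\<psi> x) * r)\<^sup>2"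
      using sq[of "\<bar>V x\<bar>" "norm (\<psi> x) * r"] r by simp
    moreover have "(norm (\<psi> x) * r)\<^sup>2 \<le> norm (\<psi> x) ^ 4 + (r\<^sup>2)\<^sup>2"
      using sq[of "(norm (\<psi> x))\<^sup>2" "r\<^sup>2"] by (simp add: power_mult_distrib flip: power_mult)
    moreover have "(r\<^sup>2)\<^sup>2 \<le> decay (norm x) powr (4/3)"
    proof (cases "r = 0")
      case False
      then have "(r\<^sup>2)\<^sup>2 = (r\<^sup>2) powr 2" by (simp add: powr_numeral)
      also have "\<dots> \<le> (r\<^sup>2) powr (4/3)"
        using r False by (intro powr_mono') (auto simp: power_le_one)
      also have "\<dots> \<le> decay (norm x) powr (4/3)"
        using decay_ge_square[of "norm x"] elim by (intro powr_mono2) (auto simp: r_def power_divide)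
      finally show ?thesis .
    qed simp
    ultimately have "\<bar>V x\<bar> * (norm (\<psi> x) * r) \<le> ?b x" by simp
    then show ?case by (simp add: r_def)
  qed
qed measurable

lemma integrable_green:
  assumes "d > 0"
  shows "integrable lborel (\<lambda>x. green_hess a d i k x *\<^sub>R \<psi> x)"
    and "integrable lborel (\<lambda>x. green_grad a d k x *\<^sub>R V x *\<^sub>R \<psi> x)"
proof -
  obtain C where C: "C > 0" "\<And>x k. \<bar>green_grad a d k x\<bar> \<le> C / (1 + norm x)"
    "\<And>x i k. \<bar>green_hess a d i k x\<bar> \<le> C / (1 + norm x)\<^sup>2"
    using green_bounds[OF assms, of a] by blast
  have nz: "AE x::plane in lborel. x \<noteq> 0" by (rule AE_lborel_singleton)
  show "integrable lborel (\<lambda>x. green_hess a d i k x *\<^sub>R \<psi> x)"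
  proof (rule Bochner_Integration.integrable_bound)
    show "integrable lborel (\<lambda>x. C * (norm (\<psi> x) * decay (norm x)))"
      by (intro integrable_mult_right integrable_decay_\<psi>)
    show "AE x in lborel. norm (green_hess a d i k x *\<^sub>R \<psi> x) \<le> norm (C * (norm (\<psi> x) * decay (norm x)))"
      using nz
    proof eventually_elim
      case (elim x)
      have "\<bar>green_hess a d i k x\<bar> \<le> C * (1 / (1 + norm x)\<^sup>2)" using C(3)[of i k x] by simp
      also have "\<dots> \<le> C * decay (norm x)" using decay_ge_square[of "norm x"] elim C by (intro mult_left_mono) auto
      finally have "norm (green_hess a d i k x *\<^sub>R \<psi> x) \<le> C * decay (norm x) * norm (\<psi> x)"
        by (simp add: mult_right_mono)
      also have "\<dots> = C * (norm (\<psi> x) * decay (norm x))" by (simp add: mult_ac)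
      also have "\<dots> \<le> norm \<dots>" unfolding real_norm_def by (rule abs_ge_self)
      finally show ?case .
    qed
  qed measurable
  show "integrable lborel (\<lambda>x. green_grad a d k x *\<^sub>R V x *\<^sub>R \<psi> x)"
  proof (rule Bochner_Integration.integrable_bound)
    show "integrable lborel (\<lambda>x. C * (\<bar>V x\<bar> * norm (\<psi> x) / (1 + norm x)))"
      by (intro integrable_mult_right integrable_V_\<psi>)
    show "AE x in lborel. norm (green_grad a d k x *\<^sub>R V x *\<^sub>R \<psi> x)
        \<le> norm (C * (\<bar>V x\<bar> * norm (\<psi> x) / (1 + norm x)))"
    proof (rule AE_I2)
      fix x
      have "norm (green_grad a d k x *\<^sub>R V x *\<^sub>R \<psi> x) \<le> C / (1 + norm x) * (\<bar>V x\<bar> * norm (\<psi> x))"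
        using mult_right_mono[OF C(2)[of k x], of "\<bar>V x\<bar> * norm (\<psi> x)"] by (simp add: abs_mult)
      also have "\<dots> = C * (\<bar>V x\<bar> * norm (\<psi> x) / (1 + norm x))" by simp
      also have "\<dots> \<le> norm \<dots>" unfolding real_norm_def by (rule abs_ge_self)
      finally show "norm (green_grad a d k x *\<^sub>R V x *\<^sub>R \<psi> x) \<le> norm (C * (\<bar>V x\<bar> * norm (\<psi> x) / (1 + norm x)))" .
    qed
  qed measurable
qed

text \<open>The test function is the cutoff times one component of the Green gradient. The terms
  containing the cutoff gradient vanish pointwise in the limit and are dominated by a multiple of
  |\<psi>| \<open>decay\<close>, which is integrable; this is where the origin becomes
  removable.\<close>

lemma green_equation:
  assumes d: "d > 0"
  shows "(\<Sum>i\<in>UNIV. e i *v (LINT x|lborel. green_hess a d i k x *\<^sub>R \<psi> x))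
    = (LINT x|lborel. green_grad a d k x *\<^sub>R V x *\<^sub>R \<psi> x)"
proof -
  obtain C where C: "C > 0" "\<And>x k. \<bar>green_grad a d k x\<bar> \<le> C / (1 + norm x)"
    "\<And>x i k. \<bar>green_hess a d i k x\<bar> \<le> C / (1 + norm x)\<^sup>2"
    using green_bounds[OF d, of a] by blast
  obtain B where B: "B > 0" "\<And>n x. n > 0 \<Longrightarrow> \<bar>cutoff_deriv n x\<bar> * (norm x)\<^sup>2 \<le> B"
    using cutoff_deriv_bounded by blast
  define \<phi> where "\<phi> m x = cutoff (real (Suc m)) x * green_grad a d k x" for m x
  define D where "D m i x = cutoff (real (Suc m)) x * green_hess a d i k x
      + cutoff_deriv (real (Suc m)) x * x $ i * green_grad a d k x" for m i x
  have nz: "AE x::plane in lborel. x \<noteq> 0" by (rule AE_lborel_singleton)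
  have [measurable]: "step \<in> borel_measurable borel" "deriv step \<in> borel_measurable borel"
    using continuous_on_deriv_step smooth_step
    by (auto simp only: smooth_def C_k.simps(1)[symmetric] intro: borel_measurable_continuous_onI)
  have [measurable]: "cutoff n \<in> borel_measurable borel" for n
    unfolding cutoff_def[abs_def] by measurable
  have [measurable]: "cutoff_deriv n \<in> borel_measurable borel" for n
    unfolding cutoff_deriv_def[abs_def] by measurable
  have deriv: "frechet_derivative (\<phi> m) (at x) (axis i 1) = D m i x" for m i x
  proof -
    have "(\<phi> m has_derivative (\<lambda>v. cutoff (real (Suc m)) x * (\<Sum>i\<in>UNIV. v $ i * green_hess a d i k x)
        + cutoff_deriv (real (Suc m)) x * (x \<bullet> v) * green_grad a d k x)) (at x)"
      unfolding \<phi>_def by (rule has_derivative_mult[OF has_derivative_cutoff has_derivative_green_grad[OF d]])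
    from frechet_derivative_at[OF this, symmetric] show ?thesis
      using exhaust_2[of i] by (auto simp: D_def sum_2 axis_def inner_axis inner_vec_def)
  qed
  have eq: "(\<Sum>i\<in>UNIV. e i *v (LINT x|lborel. D m i x *\<^sub>R \<psi> x)) = (LINT x|lborel. \<phi> m x *\<^sub>R V x *\<^sub>R \<psi> x)" for m
  proof -
    have "\<phi> m \<in> test_functions (UNIV - {0})"
      unfolding \<phi>_def[abs_def] by (intro cutoff_test_function smooth_green_grad d) simp
    from equation[OF this] show ?thesis by (simp only: deriv)
  qed
  have "(\<lambda>m. LINT x|lborel. D m i x *\<^sub>R \<psi> x) \<longlonglongrightarrow> (LINT x|lborel. green_hess a d i k x *\<^sub>R \<psi> x)" for i
  proof (rule integral_dominated_convergence[where w="\<lambda>x. C * (1 + B) * (norm (\<psi> x) * decay (norm x))"])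
    show "integrable lborel (\<lambda>x. C * (1 + B) * (norm (\<psi> x) * decay (norm x)))"
      by (intro integrable_mult_right integrable_decay_\<psi>)
    show "AE x in lborel. (\<lambda>m. D m i x *\<^sub>R \<psi> x) \<longlonglongrightarrow> green_hess a d i k x *\<^sub>R \<psi> x"
      using nz
    proof eventually_elim
      case (elim x)
      show ?case
        by (rule tendsto_eventually) (auto intro: eventually_mono[OF cutoff_eventually[OF elim]] simp: D_def)
    qed
    show "AE x in lborel. norm (D m i x *\<^sub>R \<psi> x) \<le> C * (1 + B) * (norm (\<psi> x) * decay (norm x))" for m
      using nz
    proof eventually_elim
      case (elim x)
      define n where "n = real (Suc m)"
      have r: "norm x > 0" using elim by simp
      have "\<bar>cutoff n x * green_hess a d i k x\<bar> \<le> 1 * (C / (1 + norm x)\<^sup>2)"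
        unfolding abs_mult using cutoff_bounds[of n x] C by (intro mult_mono) auto
      also have "\<dots> \<le> C * decay (norm x)"
        using mult_left_mono[OF decay_ge_square[OF r], of C] C by simp
      finally have 1: "\<bar>cutoff n x * green_hess a d i k x\<bar> \<le> C * decay (norm x)" .
      \<comment> \<open>The bound B/|x| on the cutoff gradient times C/(1 + |x|) on the Green
        gradient is at most C B \<open>decay\<close>, near 0 and at infinity alike.\<close>
      have "\<bar>cutoff_deriv n x\<bar> * \<bar>x $ i\<bar> \<le> \<bar>cutoff_deriv n x\<bar> * norm x"
        by (intro mult_left_mono component_le_norm_cart) auto
      also have "\<dots> \<le> B / norm x"
        using B(2)[of n x] r by (simp add: n_def field_simps power2_eq_square)
      finally have "\<bar>cutoff_deriv n x * x $ i * green_grad a d k x\<bar> \<le> B / norm x * (C / (1 + norm x))"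
        unfolding abs_mult using C B r by (intro mult_mono) auto
      also have "\<dots> = C * B * (1 / (norm x * (1 + norm x)))" by simp
      also have "\<dots> \<le> C * B * decay (norm x)"
        using C B by (intro mult_left_mono decay_ge_product[OF r]) auto
      finally have "\<bar>D m i x\<bar> \<le> C * decay (norm x) + C * B * decay (norm x)"
        using 1 unfolding D_def n_def[symmetric] by linarith
      then have "\<bar>D m i x\<bar> * norm (\<psi> x) \<le> (C * decay (norm x) + C * B * decay (norm x)) * norm (\<psi> x)"
        by (rule mult_right_mono) simp
      then show ?case by (simp add: algebra_simps)
    qed
  qed (unfold D_def, measurable)
  then have "(\<lambda>m. \<Sum>i\<in>UNIV. e i *v (LINT x|lborel. D m i x *\<^sub>R \<psi> x))
      \<longlonglongrightarrow> (\<Sum>i\<in>UNIV. e i *v (LINT x|lborel. green_hess a d i k x *\<^sub>R \<psi> x))"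
    by (intro tendsto_sum bounded_linear.tendsto[OF matrix_vector_mul_bounded_linear])
  moreover have "(\<lambda>m. LINT x|lborel. \<phi> m x *\<^sub>R V x *\<^sub>R \<psi> x)
      \<longlonglongrightarrow> (LINT x|lborel. green_grad a d k x *\<^sub>R V x *\<^sub>R \<psi> x)"
  proof (rule integral_dominated_convergence[where w="\<lambda>x. norm (green_grad a d k x *\<^sub>R V x *\<^sub>R \<psi> x)"])
    show "integrable lborel (\<lambda>x. norm (green_grad a d k x *\<^sub>R V x *\<^sub>R \<psi> x))"
      by (intro integrable_norm integrable_green d)
    show "AE x in lborel. (\<lambda>m. \<phi> m x *\<^sub>R V x *\<^sub>R \<psi> x) \<longlonglongrightarrow> green_grad a d k x *\<^sub>R V x *\<^sub>R \<psi> x"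
      using nz
    proof eventually_elim
      case (elim x)
      show ?case
        by (rule tendsto_eventually) (auto intro: eventually_mono[OF cutoff_eventually[OF elim]] simp: \<phi>_def)
    qed
    show "AE x in lborel. norm (\<phi> m x *\<^sub>R V x *\<^sub>R \<psi> x) \<le> norm (green_grad a d k x *\<^sub>R V x *\<^sub>R \<psi> x)" for m
    proof (rule AE_I2)
      fix x
      have "\<bar>\<phi> m x\<bar> \<le> \<bar>green_grad a d k x\<bar>"
        using cutoff_bounds[of "real (Suc m)" x] by (simp add: \<phi>_def abs_mult mult_left_le_one_le)
      then show "norm (\<phi> m x *\<^sub>R V x *\<^sub>R \<psi> x) \<le> norm (green_grad a d k x *\<^sub>R V x *\<^sub>R \<psi> x)"
        unfolding norm_scaleR by (intro mult_right_mono) auto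
    qed
  qed (unfold \<phi>_def, measurable)
  ultimately show ?thesis
    unfolding eq by (rule LIMSEQ_unique)
qed

text \<open>Applying \<open>e k\<close> to the tested equations and summing over k leaves the trace
  of the Hessian, that is the bump, on the left. The factor 8 is two components times the crude
  bound 4 for Clifford multiplication.\<close>

lemma norm_bump_integral_le:
  assumes d: "d > 0"
  shows "ennreal (norm (LINT x|lborel. bump a d x *\<^sub>R \<psi> x))
    \<le> 8 * (\<integral>\<^sup>+x. ennreal (\<bar>V x\<bar> * norm (\<psi> x) / norm (x - a)) \<partial>lborel)"
proof -
  define A where "A i k = (LINT x|lborel. green_hess a d i k x *\<^sub>R \<psi> x)" for i k
  define J where "J k = (LINT x|lborel. green_grad a d k x *\<^sub>R V x *\<^sub>R \<psi> x)" for k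
  define R where "R = (\<integral>\<^sup>+x. ennreal (\<bar>V x\<bar> * norm (\<psi> x) / norm (x - a)) \<partial>lborel)"
  have "(LINT x|lborel. bump a d x *\<^sub>R \<psi> x) = A 1 1 + A 2 2"
    unfolding A_def
    by (subst Bochner_Integration.integral_add[symmetric])
      (auto intro: integrable_green d simp: green_hess_trace[OF d] simp flip: scaleR_left_distrib)
  moreover have "A 1 2 = A 2 1" unfolding A_def by (subst green_hess_sym) simp
  ultimately have "- (LINT x|lborel. bump a d x *\<^sub>R \<psi> x) = (\<Sum>k\<in>UNIV. e k *v (\<Sum>i\<in>UNIV. e i *v A i k))"
    using clifford_laplace[OF clifford, of A] by simp
  also have "\<dots> = (\<Sum>k\<in>UNIV. e k *v (LINT x|lborel. green_grad a d k x *\<^sub>R V x *\<^sub>R \<psi> x))"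
    unfolding A_def green_equation[OF d] by simp
  finally have "- (LINT x|lborel. bump a d x *\<^sub>R \<psi> x) = (\<Sum>k\<in>UNIV. e k *v J k)"
    by (simp only: J_def)
  from arg_cong[OF this, of norm]
  have "norm (LINT x|lborel. bump a d x *\<^sub>R \<psi> x) = norm (\<Sum>k\<in>UNIV. e k *v J k)"
    by (simp only: norm_minus_cancel)
  also have "\<dots> \<le> (\<Sum>k\<in>UNIV. norm (e k *v J k))"
    by (rule norm_sum)
  also have "\<dots> \<le> (\<Sum>k\<in>UNIV. 4 * norm (J k))"
    by (intro sum_mono norm_clifford_mult_le clifford)
  finally have "ennreal (norm (LINT x|lborel. bump a d x *\<^sub>R \<psi> x)) \<le> ennreal (\<Sum>k\<in>UNIV. 4 * norm (J k))"
    by (rule ennreal_leI)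
  also have "\<dots> = (\<Sum>k\<in>UNIV. 4 * ennreal (norm (J k)))"
    by (simp only: sum_2 ennreal_plus ennreal_mult' ennreal_numeral zero_le_numeral norm_ge_zero
      mult_nonneg_nonneg)
  also have "\<dots> \<le> (\<Sum>k\<in>(UNIV::2 set). 4 * R)"
  proof (intro sum_mono mult_left_mono)
    fix k
    have "ennreal (norm (LINT x|lborel. green_grad a d k x *\<^sub>R V x *\<^sub>R \<psi> x))
        \<le> (\<integral>\<^sup>+x. ennreal (norm (green_grad a d k x *\<^sub>R V x *\<^sub>R \<psi> x)) \<partial>lborel)"
      by (intro integral_norm_bound_ennreal integrable_green d)
    also have "\<dots> \<le> R"
      unfolding R_def
    proof (rule nn_integral_mono_AE)
      have "AE x in lborel. x \<noteq> a" by (rule AE_lborel_singleton)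
      then show "AE x in lborel. ennreal (norm (green_grad a d k x *\<^sub>R V x *\<^sub>R \<psi> x))
          \<le> ennreal (\<bar>V x\<bar> * norm (\<psi> x) / norm (x - a))"
      proof eventually_elim
        case (elim x)
        then have r: "norm (x - a) > 0" by simp
        \<comment> \<open>Dropping d^2 from the denominator makes the bound uniform in
          \<open>d\<close>.\<close>
        have "\<bar>green_grad a d k x\<bar> \<le> norm (x - a) / (norm (x - a))\<^sup>2"
          unfolding green_grad_def abs_mult divide_inverse
          using component_le_norm_cart[of "x - a" k] r green_denom_pos[OF d, of a x]
          by (intro mult_mono) (auto simp: green_denom_def)
        also have "\<dots> = 1 / norm (x - a)" using r by (simp add: power2_eq_square)
        finally have "\<bar>green_grad a d k x\<bar> * (\<bar>V x\<bar> * norm (\<psi> x)) \<le> 1 / norm (x - a) * (\<bar>V x\<bar> * norm (\<psi> x))"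
          by (intro mult_right_mono) auto
        then show ?case by (intro ennreal_leI) (simp add: abs_mult mult.assoc)
      qed
    qed
    finally show "ennreal (norm (J k)) \<le> R" by (simp only: J_def)
  qed auto
  also have "\<dots> = 8 * R" by (simp add: mult.assoc[symmetric])
  finally show ?thesis unfolding R_def .
qed

end

section \<open>Mollification\<close>

lemma integral_plane_affine:
  fixes f :: "plane \<Rightarrow> 'b::{banach, second_countable_topology}"
  assumes [measurable]: "f \<in> borel_measurable borel" and c: "c \<noteq> 0"
  shows "(LINT x|lborel. f x) = c\<^sup>2 *\<^sub>R (LINT x|lborel. f (t + c *\<^sub>R x))"
proof -
  have "(LINT x|lborel. f x) = (LINT x|density (distr lborel borel (\<lambda>x. t + c *\<^sub>R x)) (\<lambda>_. \<bar>c\<bar>^DIM(plane)). f x)"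
    using lborel_affine[OF c, of t] by simp
  also have "\<dots> = (LINT x|distr lborel borel (\<lambda>x. t + c *\<^sub>R x). (\<bar>c\<bar>^DIM(plane)) *\<^sub>R f x)"
    by (subst integral_density) auto
  also have "\<dots> = c\<^sup>2 *\<^sub>R (LINT x|lborel. f (t + c *\<^sub>R x))"
    by (subst integral_distr) auto
  finally show ?thesis .
qed

text \<open>The value is 2 \<pi>; the argument uses only that it is finite and positive.\<close>

definition bump_mass :: real where
  "bump_mass = (LINT y|lborel. bump 0 1 y)"

lemma bump_nonneg: "bump a d x \<ge> 0"
  by (simp add: bump_def)

lemma bump_measurable_pair [measurable]:
  "(\<lambda>(a, x). bump a d x) \<in> borel_measurable (borel \<Otimes>\<^sub>M borel)"
  unfolding bump_def green_denom_def by measurable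

lemma bump_sym: "bump a d x = bump x d a"
  by (simp add: bump_def green_denom_def norm_minus_commute)

lemma bump_le: "d > 0 \<Longrightarrow> bump a d x \<le> 2 / d\<^sup>2"
proof -
  assume d: "d > 0"
  have "2 * d\<^sup>2 / (green_denom a d x)\<^sup>2 \<le> 2 * d\<^sup>2 / (d\<^sup>2)\<^sup>2"
    using d by (intro divide_left_mono power_mono) (auto simp: green_denom_def)
  also have "\<dots> = 2 / d\<^sup>2" using d by (simp add: power2_eq_square)
  finally show ?thesis by (simp add: bump_def)
qed

lemma bump_scale:
  assumes "d > 0" shows "d\<^sup>2 * bump (x + d *\<^sub>R y) d x = bump 0 1 y"
proof -
  have "norm (x - (x + d *\<^sub>R y)) = d * norm y" using assms by simp
  then have "green_denom (x + d *\<^sub>R y) d x = d\<^sup>2 * green_denom 0 1 y"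
    by (simp add: green_denom_def power_mult_distrib distrib_left)
  then show ?thesis using assms by (simp add: bump_def power2_eq_square)
qed

text \<open>With q = 1/(1 + |x|^2), both q <= 1 and q <= \<open>decay\<close> hold, so q^2 is at
  most q^(4/3) and hence at most the integrable power of \<open>decay\<close>.\<close>

lemma integrable_bump_profile: "integrable lborel (bump 0 1)"
proof (rule Bochner_Integration.integrable_bound)
  show "integrable lborel (\<lambda>x::plane. 2 * decay (norm x) powr (4/3))"
    by (intro integrable_mult_right integrable_decay)
  have "AE x::plane in lborel. x \<noteq> 0" by (rule AE_lborel_singleton)
  then show "AE x in lborel. norm (bump 0 1 x) \<le> norm (2 * decay (norm x) powr (4/3))"
  proof eventually_elim
    case (elim x)
    define q where "q = 1 / green_denom 0 1 x"
    have pos: "green_denom 0 1 x \<ge> 1" by (simp add: green_denom_def)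
    then have q: "0 < q" "q \<le> 1" by (auto simp: q_def)
    have "norm x \<le> 1 + (norm x)\<^sup>2"
    proof -
      have "2 * norm x \<le> 1 + (norm x)\<^sup>2" using sum_squares_bound[of "norm x" 1] by simp
      then show ?thesis using norm_ge_zero[of x] by linarith
    qed
    then have "q \<le> decay (norm x)"
      using elim pos by (auto simp: q_def decay_def green_denom_def intro!: divide_left_mono mult_pos_pos add_nonneg_pos)
    have "bump 0 1 x = 2 * q powr 2" using q by (simp add: bump_def q_def power_divide powr_numeral)
    also have "\<dots> \<le> 2 * q powr (4/3)" using q by (intro mult_left_mono powr_mono') auto
    also have "\<dots> \<le> 2 * decay (norm x) powr (4/3)"
      using q \<open>q \<le> decay (norm x)\<close> by (intro mult_left_mono powr_mono2) auto
    finally show ?case using bump_nonneg[of 0 1 x] by simp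
  qed
qed measurable

lemma bump_mass_pos: "bump_mass > 0"
proof -
  have "bump_mass \<noteq> 0"
  proof
    assume "bump_mass = 0"
    then have "AE x in lborel. bump 0 1 x = 0"
      unfolding bump_mass_def
      by (subst integral_nonneg_eq_0_iff_AE[OF integrable_bump_profile, symmetric]) (auto simp: bump_nonneg)
    moreover have "bump 0 1 x > 0" for x
      using green_denom_pos[of 1 0 x] by (simp add: bump_def)
    ultimately have "AE x::plane in lborel. False"
      by (auto elim!: eventually_mono simp: less_le)
    then show False by (simp add: eventually_False ae_filter_eq_bot_iff)
  qed
  then show ?thesis by (simp add: bump_mass_def less_le bump_nonneg)
qed

lemma nn_integral_bump:
  assumes d: "d > 0"
  shows "(\<integral>\<^sup>+x. ennreal (bump a d x) \<partial>lborel) = ennreal bump_mass"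
proof -
  have "(\<integral>\<^sup>+x. ennreal (bump a d x) \<partial>lborel) = ennreal (d\<^sup>2) * (\<integral>\<^sup>+y. ennreal (bump a d (a + d *\<^sub>R y)) \<partial>lborel)"
    using d by (intro nn_integral_plane_affine) auto
  also have "\<dots> = (\<integral>\<^sup>+y. ennreal (d\<^sup>2) * ennreal (bump a d (a + d *\<^sub>R y)) \<partial>lborel)"
    by (intro nn_integral_cmult[symmetric]) measurable
  also have "\<dots> = (\<integral>\<^sup>+y. ennreal (bump 0 1 y) \<partial>lborel)"
    using bump_scale[OF d, of a] by (simp add: bump_sym[of a] bump_nonneg flip: ennreal_mult)
  also have "\<dots> = ennreal bump_mass"
    unfolding bump_mass_def by (intro nn_integral_eq_integral integrable_bump_profile) (simp add: bump_nonneg)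
  finally show ?thesis .
qed

text \<open>Convolution with the bump without dividing by its mass, so the limit as \<open>d\<close>
  tends to 0 is \<open>bump_mass\<close> times \<open>g\<close>.\<close>

definition mollify :: "(plane \<Rightarrow> real) \<Rightarrow> real \<Rightarrow> plane \<Rightarrow> real" where
  "mollify g d x = (LINT a|lborel. g a * bump a d x)"

lemma mollify_eq:
  assumes [measurable]: "g \<in> borel_measurable borel" and d: "d > 0"
  shows "mollify g d x = (LINT y|lborel. g (x + d *\<^sub>R y) * bump 0 1 y)"
proof -
  have [measurable]: "(\<lambda>a. bump a d x) \<in> borel_measurable borel"
    unfolding bump_sym[of _ d x] by measurable
  have "mollify g d x = d\<^sup>2 *\<^sub>R (LINT y|lborel. g (x + d *\<^sub>R y) * bump (x + d *\<^sub>R y) d x)"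
    unfolding mollify_def using d by (intro integral_plane_affine) auto
  also have "\<dots> = (LINT y|lborel. d\<^sup>2 * (g (x + d *\<^sub>R y) * bump (x + d *\<^sub>R y) d x))"
    by simp
  also have "\<dots> = (LINT y|lborel. g (x + d *\<^sub>R y) * bump 0 1 y)"
    using bump_scale[OF d, of x] by (intro Bochner_Integration.integral_cong) (auto simp: mult.left_commute)
  finally show ?thesis .
qed

lemma abs_mollify_le:
  assumes [measurable]: "g \<in> borel_measurable borel" and d: "d > 0" and A: "\<And>x. \<bar>g x\<bar> \<le> A"
  shows "\<bar>mollify g d x\<bar> \<le> A * bump_mass"
proof -
  have "norm (LINT y|lborel. g (x + d *\<^sub>R y) * bump 0 1 y) \<le> (LINT y|lborel. A * bump 0 1 y)"
  proof (rule Bochner_Integration.integral_norm_bound_integral)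
    show i: "integrable lborel (\<lambda>y. A * bump 0 1 y)"
      by (intro integrable_mult_right integrable_bump_profile)
    show "integrable lborel (\<lambda>y. g (x + d *\<^sub>R y) * bump 0 1 y)"
      by (rule Bochner_Integration.integrable_bound[OF i])
        (auto simp: abs_mult intro!: mult_right_mono order_trans[OF A abs_ge_self])
    show "norm (g (x + d *\<^sub>R y) * bump 0 1 y) \<le> A * bump 0 1 y" for y
      by (simp add: abs_mult bump_nonneg mult_right_mono A)
  qed
  then show ?thesis by (simp add: mollify_eq[OF _ d] bump_mass_def)
qed

text \<open>Supplies a majorant uniform in \<open>d\<close> for the limit under the integral with
  \<psi>. The bump has no compact support, so the mollified weight keeps a tail; far from the
  support of \<open>g\<close> it is of order |x|^(-4).\<close>

lemma mollify_decay:
  assumes [measurable]: "g \<in> borel_measurable borel" and A: "\<And>x. \<bar>g x\<bar> \<le> A"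
    and R: "\<And>x. norm x > R \<Longrightarrow> g x = 0"
  obtains C where "\<And>x d. x \<noteq> 0 \<Longrightarrow> 0 < d \<Longrightarrow> d \<le> 1 \<Longrightarrow> \<bar>mollify g d x\<bar> \<le> C * decay (norm x)"
proof -
  \<comment> \<open>Taking S at least 1 ensures |x| >= 1 in the far region, where |x|^(-4) is then
    below \<open>decay\<close>.\<close>
  define S where "S = max R 1"
  have S: "S \<ge> 1" "\<And>x. norm x > S \<Longrightarrow> g x = 0" using R by (auto simp: S_def)
  have A0: "A \<ge> 0" using A[of 0] by linarith
  define C1 where "C1 = A * bump_mass * (1 + 2 * S)\<^sup>2"
  define I where "I = (LINT a|lborel. A * indicator (cball (0::plane) S) a)"
  have I0: "I \<ge> 0" unfolding I_def using A0 by (intro Bochner_Integration.integral_nonneg) auto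
  have int: "integrable lborel (\<lambda>a. A * indicator (cball (0::plane) S) a)"
    by (intro integrable_mult_right integrable_real_indicator emeasure_lborel_cball_finite) auto
  show ?thesis
  proof (rule that[of "C1 + 32 * I"])
    fix x :: plane and d :: real assume x: "x \<noteq> 0" and d: "0 < d" "d \<le> 1"
    have r: "norm x > 0" using x by simp
    have [measurable]: "(\<lambda>a. bump a d x) \<in> borel_measurable borel"
      unfolding bump_sym[of _ d x] by measurable
    have dec: "decay (norm x) \<ge> 0" by (simp add: decay_nonneg)
    show "\<bar>mollify g d x\<bar> \<le> (C1 + 32 * I) * decay (norm x)"
    proof (cases "norm x \<le> 2 * S")
      case True
      have "\<bar>mollify g d x\<bar> \<le> A * bump_mass * 1" using abs_mollify_le[OF _ d(1) A] by simp
      also have "\<dots> \<le> A * bump_mass * ((1 + 2 * S)\<^sup>2 / (1 + norm x)\<^sup>2)"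
        proof (intro mult_left_mono)
          have "(1 + norm x)\<^sup>2 \<le> (1 + 2 * S)\<^sup>2" using True by (intro power_mono) auto
          moreover have "(1 + norm x)\<^sup>2 > 0" using r by (intro zero_less_power) linarith
          ultimately show "1 \<le> (1 + 2 * S)\<^sup>2 / (1 + norm x)\<^sup>2" by simp
        qed (use A0 bump_mass_pos in simp)
      also have "\<dots> = C1 * (1 / (1 + norm x)\<^sup>2)" by (simp add: C1_def)
      also have "\<dots> \<le> C1 * decay (norm x)"
        using A0 bump_mass_pos by (intro mult_left_mono decay_ge_square r) (auto simp: C1_def)
      also have "\<dots> \<le> (C1 + 32 * I) * decay (norm x)"
        using I0 dec by (intro mult_right_mono) auto
      finally show ?thesis .
    next
      case False
      \<comment> \<open>For |a| <= S and |x| > 2 S the distance |x - a| is at least |x|/2, and d <=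
        1, so the bump is at most 2 / (|x|/2)^4.\<close>
      define b where "b = 32 / norm x ^ 4"
      have pw: "norm (g a * bump a d x) \<le> A * indicator (cball 0 S) a * b" for a
      proof (cases "norm a \<le> S")
        case True
        have "norm x \<le> norm (x - a) + norm a" by norm
        then have "norm x / 2 \<le> norm (x - a)" using True False by linarith
        then have "(norm x / 2)\<^sup>2 \<le> (norm (x - a))\<^sup>2" by (intro power_mono) auto
        then have "(norm x / 2)\<^sup>2 \<le> green_denom a d x" by (simp add: green_denom_def add_increasing2)
        then have "((norm x / 2)\<^sup>2)\<^sup>2 \<le> (green_denom a d x)\<^sup>2" by (intro power_mono) auto
        then have "2 * d\<^sup>2 / (green_denom a d x)\<^sup>2 \<le> 2 * 1 / ((norm x / 2)\<^sup>2)\<^sup>2"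
          using d r by (intro frac_le mult_left_mono power_le_one) auto
        also have "\<dots> = b" by (simp add: b_def power_divide flip: power_mult)
        finally have "bump a d x \<le> b" by (simp add: bump_def)
        then show ?thesis
          using True by (simp add: abs_mult bump_nonneg mult_mono A A0)
      qed (use S in auto)
      have "norm (mollify g d x) \<le> (LINT a|lborel. A * indicator (cball (0::plane) S) a * b)"
        unfolding mollify_def
      proof (rule Bochner_Integration.integral_norm_bound_integral)
        show i: "integrable lborel (\<lambda>a. A * indicator (cball (0::plane) S) a * b)"
          by (intro integrable_mult_left int)
        show "integrable lborel (\<lambda>a. g a * bump a d x)"
          by (rule Bochner_Integration.integrable_bound[OF i])
            (auto intro!: order_trans[OF pw[unfolded real_norm_def] abs_ge_self])
      qed (rule pw)
      also have "\<dots> = I * b" by (simp add: I_def)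
      also have "\<dots> = 32 * I * (1 / norm x ^ 4)" by (simp add: b_def)
      also have "1 / norm x ^ 4 \<le> decay (norm x)"
      proof -
        have ge: "norm x \<ge> 1" using False S by simp
        have "norm x \<le> norm x ^ 4" "(norm x)\<^sup>2 \<le> norm x ^ 4"
          using power_increasing[OF _ ge, of 1 4] power_increasing[OF _ ge, of 2 4] by simp_all
        then show ?thesis using r by (auto simp: decay_def intro!: divide_left_mono)
      qed
      also have "32 * I * decay (norm x) \<le> (C1 + 32 * I) * decay (norm x)"
        using dec A0 bump_mass_pos by (intro mult_right_mono) (auto simp: C1_def)
      finally show ?thesis using I0 by (simp add: mult_left_mono)
    qed
  qed
qed

text \<open>After substitution the kernel is the fixed profile and \<open>d\<close> sits only in the
  argument of \<open>g\<close>, so continuity and boundedness of \<open>g\<close> give dominated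
  convergence.\<close>

lemma mollify_tendsto:
  assumes cont: "continuous_on UNIV g" and A: "\<And>x. \<bar>g x\<bar> \<le> A"
  shows "(\<lambda>m. mollify g (1 / real (Suc m)) x) \<longlonglongrightarrow> bump_mass * g x"
proof -
  have [measurable]: "g \<in> borel_measurable borel"
    using cont by (rule borel_measurable_continuous_onI)
  have lim: "(\<lambda>m. x + (1 / real (Suc m)) *\<^sub>R y) \<longlonglongrightarrow> x + 0 *\<^sub>R y" for y
    using LIMSEQ_inverse_real_of_nat by (intro tendsto_intros) (simp add: inverse_eq_divide)
  have "(\<lambda>m. LINT y|lborel. g (x + (1 / real (Suc m)) *\<^sub>R y) * bump 0 1 y)
      \<longlonglongrightarrow> (LINT y|lborel. g x * bump 0 1 y)"
  proof (rule integral_dominated_convergence[where w="\<lambda>y. A * bump 0 1 y"])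
    show "AE y in lborel. (\<lambda>m. g (x + (1 / real (Suc m)) *\<^sub>R y) * bump 0 1 y) \<longlonglongrightarrow> g x * bump 0 1 y"
    proof (intro AE_I2 tendsto_mult tendsto_const)
      fix y
      show "(\<lambda>m. g (x + (1 / real (Suc m)) *\<^sub>R y)) \<longlonglongrightarrow> g x"
        using continuous_on_tendsto_compose[OF cont lim[of y]] by simp
    qed
    show "integrable lborel (\<lambda>y. A * bump 0 1 y)"
      by (intro integrable_mult_right integrable_bump_profile)
  qed (auto simp: abs_mult bump_nonneg mult_right_mono A)
  then show ?thesis
    by (simp add: mollify_eq bump_mass_def mult.commute)
qed

section \<open>Pairings of the solution with scalar weights\<close>

context dirac_solution
begin

text \<open>The hypothesis for Fubini at fixed \<open>d\<close>. It follows from |\<psi>| <= 1 +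
  |\<psi>|^4: the first term integrates against the bump to its mass, the second uses the supremum
  2/d^2.\<close>

lemma integrable_bump_pairing:
  assumes [measurable]: "g \<in> borel_measurable borel" and g: "integrable lborel g" and d: "d > 0"
  shows "integrable (lborel \<Otimes>\<^sub>M lborel) (\<lambda>(a, x). (g a * bump a d x) *\<^sub>R \<psi> x)"
proof (rule integrableI_bounded)
  let ?f = "\<lambda>(a, x). (g a * bump a d x) *\<^sub>R \<psi> x"
  show "?f \<in> borel_measurable (lborel \<Otimes>\<^sub>M lborel)" by measurable
  define M where "M = (LINT x|lborel. norm (\<psi> x) ^ 4)"
  have M: "(\<integral>\<^sup>+x. ennreal (norm (\<psi> x) ^ 4) \<partial>lborel) = ennreal M" "M \<ge> 0"
    unfolding M_def by (auto intro!: nn_integral_eq_integral integrable_\<psi>)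
  have [measurable]: "(\<lambda>x. bump a d x) \<in> borel_measurable borel" for a by measurable
  have inner: "(\<integral>\<^sup>+x. ennreal (bump a d x * norm (\<psi> x)) \<partial>lborel) \<le> ennreal (bump_mass + 2 / d\<^sup>2 * M)" for a
  proof -
    have "(\<integral>\<^sup>+x. ennreal (bump a d x * norm (\<psi> x)) \<partial>lborel)
        \<le> (\<integral>\<^sup>+x. ennreal (bump a d x) + ennreal (2 / d\<^sup>2) * ennreal (norm (\<psi> x) ^ 4) \<partial>lborel)"
    proof (intro nn_integral_mono)
      fix x
      define p where "p = norm (\<psi> x)"
      have p: "p \<ge> 0" by (simp add: p_def)
      have "p \<le> 1 + p ^ 4"
      proof (cases "p \<le> 1")
        case False
        then show ?thesis using power_increasing[of 1 4 p] by simp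
      qed (use p in \<open>simp add: add_increasing2\<close>)
      then have "bump a d x * p \<le> bump a d x * (1 + p ^ 4)"
        by (intro mult_left_mono) (auto simp: bump_nonneg)
      also have "\<dots> \<le> bump a d x + 2 / d\<^sup>2 * p ^ 4"
        using mult_right_mono[OF bump_le[OF d, of a x], of "p ^ 4"] by (simp add: distrib_left)
      finally have "ennreal (bump a d x * p) \<le> ennreal (bump a d x + 2 / d\<^sup>2 * p ^ 4)"
        by (rule ennreal_leI)
      also have "\<dots> = ennreal (bump a d x) + ennreal (2 / d\<^sup>2) * ennreal (p ^ 4)"
        using d by (subst ennreal_plus) (auto simp: bump_nonneg simp flip: ennreal_mult)
      finally show "ennreal (bump a d x * norm (\<psi> x)) \<le> ennreal (bump a d x) + ennreal (2 / d\<^sup>2) * ennreal (norm (\<psi> x) ^ 4)"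
        by (simp only: p_def)
    qed
    also have "\<dots> = ennreal bump_mass + ennreal (2 / d\<^sup>2) * ennreal M"
      by (subst nn_integral_add) (auto simp: nn_integral_bump[OF d] nn_integral_cmult M)
    also have "\<dots> = ennreal (bump_mass + 2 / d\<^sup>2 * M)"
      using d M bump_mass_pos by (subst ennreal_plus) (auto simp flip: ennreal_mult)
    finally show ?thesis .
  qed
  have "(\<integral>\<^sup>+p. ennreal (norm (?f p)) \<partial>(lborel \<Otimes>\<^sub>M lborel))
      = (\<integral>\<^sup>+a. \<integral>\<^sup>+x. ennreal (norm (?f (a, x))) \<partial>lborel \<partial>lborel)"
    by (rule lborel.nn_integral_fst[symmetric]) measurable
  also have "\<dots> = (\<integral>\<^sup>+a. ennreal \<bar>g a\<bar> * (\<integral>\<^sup>+x. ennreal (bump a d x * norm (\<psi> x)) \<partial>lborel) \<partial>lborel)"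
    by (subst nn_integral_cmult[symmetric])
      (auto simp: abs_mult bump_nonneg mult.assoc simp flip: ennreal_mult)
  also have "\<dots> \<le> (\<integral>\<^sup>+a. ennreal \<bar>g a\<bar> * ennreal (bump_mass + 2 / d\<^sup>2 * M) \<partial>lborel)"
    by (intro nn_integral_mono mult_left_mono inner) auto
  also have "\<dots> = (\<integral>\<^sup>+a. ennreal \<bar>g a\<bar> \<partial>lborel) * ennreal (bump_mass + 2 / d\<^sup>2 * M)"
    by (rule nn_integral_multc) measurable
  also have "\<dots> < \<infinity>"
    using g by (auto simp: integrable_iff_bounded ennreal_mult_less_top)
  finally show "(\<integral>\<^sup>+p. ennreal (norm (?f p)) \<partial>(lborel \<Otimes>\<^sub>M lborel)) < \<infinity>" .
qed

text \<open>Fubini moves the mollifier from \<open>g\<close> to \<psi>, where the bump estimate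
  applies at each point. What remains is the Hardy-Littlewood-Sobolev form, with no \<open>d\<close>
  in it.\<close>

lemma mollify_pairing_bound:
  assumes [measurable]: "g \<in> borel_measurable borel" and g: "integrable lborel g" and d: "d > 0"
  shows "ennreal (norm (LINT x|lborel. mollify g d x *\<^sub>R \<psi> x))
    \<le> 8 * (\<integral>\<^sup>+a. \<integral>\<^sup>+x. ennreal (\<bar>g a\<bar> * (\<bar>V x\<bar> * norm (\<psi> x)) / norm (a - x)) \<partial>lborel \<partial>lborel)"
proof -
  note int = integrable_bump_pairing[OF assms]
  define \<Psi> where "\<Psi> a = (LINT x|lborel. bump a d x *\<^sub>R \<psi> x)" for a
  have inner: "(LINT x|lborel. (g a * bump a d x) *\<^sub>R \<psi> x) = g a *\<^sub>R \<Psi> a" for a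
    unfolding \<Psi>_def by (simp flip: scaleR_scaleR)
  have "(LINT x|lborel. mollify g d x *\<^sub>R \<psi> x) = (LINT x|lborel. (LINT a|lborel. (g a * bump a d x) *\<^sub>R \<psi> x))"
  proof (rule Bochner_Integration.integral_cong_AE)
    have "integrable lborel (\<lambda>a. g a * bump a d x)" for x
    proof (rule Bochner_Integration.integrable_bound)
      show "integrable lborel (\<lambda>a. g a * (2 / d\<^sup>2))" by (intro integrable_mult_left g)
      have [measurable]: "(\<lambda>a. bump a d x) \<in> borel_measurable borel"
        unfolding bump_sym[of _ d x] by measurable
      show "(\<lambda>a. g a * bump a d x) \<in> borel_measurable lborel" by measurable
      show "AE a in lborel. norm (g a * bump a d x) \<le> norm (g a * (2 / d\<^sup>2))"
        using bump_le[OF d] unfolding real_norm_def abs_mult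
        by (intro AE_I2 mult_left_mono) (auto simp: bump_nonneg)
    qed
    then show "AE x in lborel. mollify g d x *\<^sub>R \<psi> x = (LINT a|lborel. (g a * bump a d x) *\<^sub>R \<psi> x)"
      by (simp add: mollify_def)
  qed (unfold mollify_def, measurable)
  also have "\<dots> = (LINT a|lborel. (LINT x|lborel. (g a * bump a d x) *\<^sub>R \<psi> x))"
    by (rule lborel_pair.Fubini_integral[OF int])
  also have "\<dots> = (LINT a|lborel. g a *\<^sub>R \<Psi> a)"
    by (simp only: inner)
  finally have eq: "(LINT x|lborel. mollify g d x *\<^sub>R \<psi> x) = (LINT a|lborel. g a *\<^sub>R \<Psi> a)" .
  have "integrable lborel (\<lambda>a. g a *\<^sub>R \<Psi> a)"
    using lborel_pair.integrable_fst'[OF int] by (simp add: inner)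
  then have "ennreal (norm (LINT a|lborel. g a *\<^sub>R \<Psi> a)) \<le> (\<integral>\<^sup>+a. ennreal (norm (g a *\<^sub>R \<Psi> a)) \<partial>lborel)"
    by (rule integral_norm_bound_ennreal)
  also have "\<dots> \<le> (\<integral>\<^sup>+a. 8 * (\<integral>\<^sup>+x. ennreal (\<bar>g a\<bar> * (\<bar>V x\<bar> * norm (\<psi> x)) / norm (a - x)) \<partial>lborel) \<partial>lborel)"
  proof (intro nn_integral_mono)
    fix a
    have "ennreal (norm (g a *\<^sub>R \<Psi> a)) = ennreal \<bar>g a\<bar> * ennreal (norm (\<Psi> a))"
      by (simp add: ennreal_mult)
    also have "\<dots> \<le> ennreal \<bar>g a\<bar> * (8 * (\<integral>\<^sup>+x. ennreal (\<bar>V x\<bar> * norm (\<psi> x) / norm (x - a)) \<partial>lborel))"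
      unfolding \<Psi>_def by (intro mult_left_mono norm_bump_integral_le d) auto
    also have "\<dots> = 8 * (\<integral>\<^sup>+x. ennreal \<bar>g a\<bar> * ennreal (\<bar>V x\<bar> * norm (\<psi> x) / norm (x - a)) \<partial>lborel)"
      by (subst nn_integral_cmult) (auto simp: mult.left_commute)
    also have "\<dots> = 8 * (\<integral>\<^sup>+x. ennreal (\<bar>g a\<bar> * (\<bar>V x\<bar> * norm (\<psi> x)) / norm (a - x)) \<partial>lborel)"
      by (simp add: norm_minus_commute[of a] flip: ennreal_mult)
    finally show "ennreal (norm (g a *\<^sub>R \<Psi> a))
        \<le> 8 * (\<integral>\<^sup>+x. ennreal (\<bar>g a\<bar> * (\<bar>V x\<bar> * norm (\<psi> x)) / norm (a - x)) \<partial>lborel)" .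
  qed
  also have "\<dots> = 8 * (\<integral>\<^sup>+a. \<integral>\<^sup>+x. ennreal (\<bar>g a\<bar> * (\<bar>V x\<bar> * norm (\<psi> x)) / norm (a - x)) \<partial>lborel \<partial>lborel)"
    by (rule nn_integral_cmult) measurable
  finally show ?thesis by (simp only: eq)
qed

text \<open>The bound for mollified weights is uniform, so it survives d = 1/(m+1) tending to 0.
  Continuity of \<open>g\<close> is what makes the mollifications converge pointwise.\<close>

lemma pairing_bound_continuous:
  assumes cont: "continuous_on UNIV g" and A: "\<And>x. \<bar>g x\<bar> \<le> A"
    and R: "\<And>x. norm x > R \<Longrightarrow> g x = 0" and pos: "F > 0" "G > 0"
    and G: "(\<integral>\<^sup>+x. ennreal (\<bar>g x\<bar> powr (4/3)) \<partial>lborel) \<le> ennreal G"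
    and F: "(\<integral>\<^sup>+x. ennreal ((\<bar>V x\<bar> * norm (\<psi> x)) powr (4/3)) \<partial>lborel) \<le> ennreal F"
  shows "bump_mass * norm (LINT x|lborel. g x *\<^sub>R \<psi> x)
    \<le> 8 * (1 + 2 * decay_const) * (G powr (3/4) * F powr (3/4))"
proof -
  have gm [measurable]: "g \<in> borel_measurable borel"
    using cont by (rule borel_measurable_continuous_onI)
  have g: "integrable lborel g"
  proof (rule Bochner_Integration.integrable_bound)
    show "integrable lborel (\<lambda>x. A * indicator (cball (0::plane) R) x)"
      by (intro integrable_mult_right integrable_real_indicator emeasure_lborel_cball_finite) auto
    show "AE x in lborel. norm (g x) \<le> norm (A * indicator (cball 0 R) x)"
      using R by (intro AE_I2) (auto simp: indicator_def intro: order_trans[OF A abs_ge_self])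
  qed measurable
  obtain C where C: "\<And>x d. x \<noteq> 0 \<Longrightarrow> 0 < d \<Longrightarrow> d \<le> 1 \<Longrightarrow> \<bar>mollify g d x\<bar> \<le> C * decay (norm x)"
    using mollify_decay[OF gm A R] by blast
  let ?c = "8 * (1 + 2 * decay_const) * (G powr (3/4) * F powr (3/4))"
  let ?d = "\<lambda>m. 1 / real (Suc m)"
  have bound: "norm (LINT x|lborel. mollify g (?d m) x *\<^sub>R \<psi> x) \<le> ?c" for m
  proof -
    have "ennreal (norm (LINT x|lborel. mollify g (?d m) x *\<^sub>R \<psi> x))
        \<le> 8 * (\<integral>\<^sup>+a. \<integral>\<^sup>+x. ennreal (\<bar>g a\<bar> * (\<bar>V x\<bar> * norm (\<psi> x)) / norm (a - x)) \<partial>lborel \<partial>lborel)"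
      by (rule mollify_pairing_bound) (use g in auto)
    also have "\<dots> \<le> 8 * ennreal ((1 + 2 * decay_const) * (G powr (3/4) * F powr (3/4)))"
      using G F pos by (intro mult_left_mono Hardy_Littlewood_Sobolev) auto
    also have "\<dots> = ennreal ?c"
      using decay_const_nonneg by (simp only: mult.assoc ennreal_mult' ennreal_numeral zero_le_numeral)
    finally show ?thesis
      using decay_const_nonneg by (subst (asm) ennreal_le_iff) auto
  qed
  have "(\<lambda>m. LINT x|lborel. mollify g (?d m) x *\<^sub>R \<psi> x) \<longlonglongrightarrow> (LINT x|lborel. (bump_mass * g x) *\<^sub>R \<psi> x)"
  proof (rule integral_dominated_convergence[where w="\<lambda>x. C * (norm (\<psi> x) * decay (norm x))"])
    show "integrable lborel (\<lambda>x. C * (norm (\<psi> x) * decay (norm x)))"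
      by (intro integrable_mult_right integrable_decay_\<psi>)
    show "AE x in lborel. (\<lambda>m. mollify g (?d m) x *\<^sub>R \<psi> x) \<longlonglongrightarrow> (bump_mass * g x) *\<^sub>R \<psi> x"
      by (intro AE_I2 tendsto_scaleR tendsto_const mollify_tendsto[OF cont A])
    have nz: "AE x::plane in lborel. x \<noteq> 0" by (rule AE_lborel_singleton)
    show "AE x in lborel. norm (mollify g (?d m) x *\<^sub>R \<psi> x) \<le> C * (norm (\<psi> x) * decay (norm x))" for m
      using nz
    proof eventually_elim
      case (elim x)
      from mult_right_mono[OF C[OF elim, of "?d m"], of "norm (\<psi> x)"]
      show ?case by (simp add: mult_ac)
    qed
  qed (unfold mollify_def, measurable)
  then have "(\<lambda>m. norm (LINT x|lborel. mollify g (?d m) x *\<^sub>R \<psi> x)) \<longlonglongrightarrow> norm (LINT x|lborel. (bump_mass * g x) *\<^sub>R \<psi> x)"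
    by (rule tendsto_norm)
  then have "norm (LINT x|lborel. (bump_mass * g x) *\<^sub>R \<psi> x) \<le> ?c"
    by (rule LIMSEQ_le_const2) (use bound in auto)
  moreover have "(LINT x|lborel. (bump_mass * g x) *\<^sub>R \<psi> x) = bump_mass *\<^sub>R (LINT x|lborel. g x *\<^sub>R \<psi> x)"
    by (simp flip: scaleR_scaleR)
  ultimately show ?thesis using bump_mass_pos by simp
qed

text \<open>A measurable weight is an almost everywhere limit of continuous ones. The strict
  inequality for \<open>G\<close> leaves room for the approximants to satisfy the bound
  eventually.\<close>

lemma pairing_bound:
  assumes [measurable]: "g \<in> borel_measurable borel" and A: "\<And>x. \<bar>g x\<bar> \<le> A"
    and R: "\<And>x. norm x > R \<Longrightarrow> g x = 0" and pos: "F > 0"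
    and G: "(LINT x|lborel. \<bar>g x\<bar> powr (4/3)) < G"
    and F: "(\<integral>\<^sup>+x. ennreal ((\<bar>V x\<bar> * norm (\<psi> x)) powr (4/3)) \<partial>lborel) \<le> ennreal F"
  shows "bump_mass * norm (LINT x|lborel. g x *\<^sub>R \<psi> x)
    \<le> 8 * (1 + 2 * decay_const) * (G powr (3/4) * F powr (3/4))"
proof -
  have A0: "A \<ge> 0" using A[of 0] by linarith
  have "g measurable_on UNIV"
    by (rule lebesgue_measurable_imp_measurable_on) (auto intro: measurable_completion)
  then obtain N h where N: "negligible N" and h: "\<And>n. continuous_on UNIV (h n)"
    and lim: "\<And>x. x \<notin> N \<Longrightarrow> (\<lambda>n. h n x) \<longlonglongrightarrow> g x"
    unfolding measurable_on_def by auto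
  have AE_N: "AE x in lborel. x \<notin> N"
  proof -
    have "AE x in lebesgue. x \<notin> N"
      using N unfolding negligible_iff_null_sets by (rule AE_not_in)
    then show ?thesis by (simp add: AE_completion_iff)
  qed
  define \<theta> where "\<theta> x = max 0 (min 1 (R + 1 - norm x))" for x :: plane
  \<comment> \<open>Clamping to [-A, A] and cutting off outside radius R + 1 provides dominating
    functions; neither operation changes the limit \<open>g\<close>.\<close>
  define k where "k n x = max (- A) (min A (h n x)) * \<theta> x" for n x
  have \<theta>: "0 \<le> \<theta> x" "\<theta> x \<le> 1" "norm x > R + 1 \<Longrightarrow> \<theta> x = 0" "norm x \<le> R \<Longrightarrow> \<theta> x = 1" for x
    by (auto simp: \<theta>_def)
  have cont: "continuous_on UNIV (k n)" for n
    unfolding k_def \<theta>_def by (intro continuous_intros h)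
  then have [measurable]: "k n \<in> borel_measurable borel" for n
    by (rule borel_measurable_continuous_onI)
  have k_le: "\<bar>k n x\<bar> \<le> A * indicator (cball 0 (R + 1)) x" for n x
  proof (cases "norm x \<le> R + 1")
    case True
    have "\<bar>k n x\<bar> \<le> A * 1"
      unfolding k_def abs_mult using \<theta>[of x] A0 by (intro mult_mono) auto
    then show ?thesis using True by simp
  qed (simp add: k_def \<theta>)
  have k_A: "\<bar>k n x\<bar> \<le> A" and k_0: "norm x > R + 1 \<Longrightarrow> k n x = 0" for n x
    using k_le[of n x] A0 by (auto simp: indicator_def of_bool_def split: if_splits)
  have k_lim: "(\<lambda>n. k n x) \<longlonglongrightarrow> g x" if "x \<notin> N" for x
  proof -
    have "(\<lambda>n. k n x) \<longlonglongrightarrow> max (- A) (min A (g x)) * \<theta> x"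
      unfolding k_def by (intro tendsto_intros lim that)
    moreover have "max (- A) (min A (g x)) = g x" using A[of x] by auto
    moreover have "g x * \<theta> x = g x" using \<theta>(4)[of x] R[of x] by (cases "norm x \<le> R") auto
    ultimately show ?thesis by simp
  qed
  have ball: "integrable lborel (\<lambda>x. indicator (cball (0::plane) r) x :: real)" for r
    by (intro integrable_real_indicator emeasure_lborel_cball_finite) auto
  have "(\<lambda>n. LINT x|lborel. k n x *\<^sub>R \<psi> x) \<longlonglongrightarrow> (LINT x|lborel. g x *\<^sub>R \<psi> x)"
  proof (rule integral_dominated_convergence[where w="\<lambda>x. A * (norm (\<psi> x) ^ 4 + indicator (cball 0 (R + 1)) x)"])
    show "integrable lborel (\<lambda>x. A * (norm (\<psi> x) ^ 4 + indicator (cball 0 (R + 1)) x))"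
      by (intro integrable_mult_right Bochner_Integration.integrable_add integrable_\<psi> ball)
    show "AE x in lborel. (\<lambda>n. k n x *\<^sub>R \<psi> x) \<longlonglongrightarrow> g x *\<^sub>R \<psi> x"
      using AE_N by eventually_elim (intro tendsto_intros k_lim)
    show "AE x in lborel. norm (k n x *\<^sub>R \<psi> x) \<le> A * (norm (\<psi> x) ^ 4 + indicator (cball 0 (R + 1)) x)" for n
    proof (rule AE_I2)
      fix x
      have "\<bar>k n x\<bar> * norm (\<psi> x) \<le> A * indicator (cball 0 (R + 1)) x * norm (\<psi> x)"
        by (intro mult_right_mono k_le) auto
      also have "\<dots> = A * (norm (\<psi> x) * indicator (cball 0 (R + 1)) x)" by simp
      also have "\<dots> \<le> A * (norm (\<psi> x) ^ 4 + indicator (cball 0 (R + 1)) x)"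
        using mult_le_power4_add[of "norm (\<psi> x)" 1] A0
        by (intro mult_left_mono) (auto simp: indicator_def)
      finally show "norm (k n x *\<^sub>R \<psi> x) \<le> A * (norm (\<psi> x) ^ 4 + indicator (cball 0 (R + 1)) x)" by simp
    qed
  qed measurable
  then have lim1: "(\<lambda>n. bump_mass * norm (LINT x|lborel. k n x *\<^sub>R \<psi> x)) \<longlonglongrightarrow> bump_mass * norm (LINT x|lborel. g x *\<^sub>R \<psi> x)"
    by (intro tendsto_intros)
  have powr_le: "\<bar>k n x\<bar> powr (4/3) \<le> A powr (4/3) * indicator (cball 0 (R + 1)) x" for n x
    using k_A[of n x] k_0[where x=x and n=n] by (auto simp: indicator_def intro!: powr_mono2)
  have int_pow: "integrable lborel (\<lambda>x. A powr (4/3) * indicator (cball (0::plane) (R + 1)) x)"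
    by (intro integrable_mult_right ball)
  have "(\<lambda>n. LINT x|lborel. \<bar>k n x\<bar> powr (4/3)) \<longlonglongrightarrow> (LINT x|lborel. \<bar>g x\<bar> powr (4/3))"
  proof (rule integral_dominated_convergence[OF _ _ int_pow])
    show "AE x in lborel. (\<lambda>n. \<bar>k n x\<bar> powr (4/3)) \<longlonglongrightarrow> \<bar>g x\<bar> powr (4/3)"
      using AE_N
    proof eventually_elim
      case (elim x)
      have "(\<lambda>n. \<bar>k n x\<bar>) \<longlonglongrightarrow> \<bar>g x\<bar>" by (intro tendsto_intros k_lim elim)
      then show ?case by (rule tendsto_powr') auto
    qed
  qed (use powr_le in auto)
  then have ev: "\<forall>\<^sub>F n in sequentially. (LINT x|lborel. \<bar>k n x\<bar> powr (4/3)) < G"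
    using G by (rule order_tendstoD)
  have G0: "G > 0"
    by (rule le_less_trans[OF Bochner_Integration.integral_nonneg G]) simp
  show ?thesis
  proof (rule tendsto_upperbound[OF lim1])
    show "\<forall>\<^sub>F n in sequentially. bump_mass * norm (LINT x|lborel. k n x *\<^sub>R \<psi> x)
        \<le> 8 * (1 + 2 * decay_const) * (G powr (3/4) * F powr (3/4))"
      using ev
    proof eventually_elim
      case (elim n)
      have "integrable lborel (\<lambda>x. \<bar>k n x\<bar> powr (4/3))"
        by (rule Bochner_Integration.integrable_bound[OF int_pow])
          (use powr_le in auto)
      then have "(\<integral>\<^sup>+x. ennreal (\<bar>k n x\<bar> powr (4/3)) \<partial>lborel) = ennreal (LINT x|lborel. \<bar>k n x\<bar> powr (4/3))"
        by (intro nn_integral_eq_integral) auto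
      also have "\<dots> \<le> ennreal G" using elim by (intro ennreal_leI) simp
      finally show ?case
        by (intro pairing_bound_continuous[OF cont k_A k_0 pos G0 _ F])
    qed
  qed simp
qed

end

section \<open>The a priori estimate\<close>

text \<open>The factor 2^(3/4) pays for the strict bound required of the weight, which is met by
  doubling its integral.\<close>

definition sobolev_const :: real where
  "sobolev_const = 8 * (1 + 2 * decay_const) * 2 powr (3/4) / bump_mass"

lemma sobolev_const_pos: "sobolev_const > 0"
  using decay_const_nonneg bump_mass_pos by (simp add: sobolev_const_def)

text \<open>The weighted arithmetic-geometric inequality for the normalised quantities v^2/W and
  p^4/M. When \<open>W\<close> and \<open>M\<close> bound the integrals of v^2 and p^4, the last
  factor integrates to at most 1, which is Hoelder's inequality.\<close>

lemma young_weighted: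
  fixes v p W M :: real
  assumes "v \<ge> 0" "p \<ge> 0" and pos: "W > 0" "M > 0"
  shows "(v * p) powr (4/3) \<le> W powr (2/3) * M powr (1/3) * (2/3 * (v\<^sup>2 / W) + 1/3 * (p ^ 4 / M))"
proof (cases "v = 0 \<or> p = 0")
  case False
  then have vp: "v > 0" "p > 0" using assms by auto
  have "v powr (4/3) = (v powr 2) powr (2/3)" "p powr (4/3) = (p powr 4) powr (1/3)"
    by (simp_all only: powr_powr) simp_all
  then have "v powr (4/3) = (v\<^sup>2) powr (2/3)" "p powr (4/3) = (p ^ 4) powr (1/3)"
    using vp by simp_all
  then have "(v * p) powr (4/3) = (W * (v\<^sup>2 / W)) powr (2/3) * (M * (p ^ 4 / M)) powr (1/3)"
    using assms by (simp add: powr_mult)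
  also have "\<dots> = W powr (2/3) * M powr (1/3) * ((v\<^sup>2 / W) powr (2/3) * (p ^ 4 / M) powr (1/3))"
    using assms by (subst (1 2) powr_mult) auto
  also have "\<dots> \<le> W powr (2/3) * M powr (1/3) * (2/3 * (v\<^sup>2 / W) + 1/3 * (p ^ 4 / M))"
    using vp pos by (intro mult_left_mono Youngs_inequality_0) auto
  finally show ?thesis .
qed (use assms in auto)

context dirac_solution
begin

lemma nn_integral_source:
  assumes W: "W > 0" "(LINT x|lborel. (V x)\<^sup>2) \<le> W" and M: "M > 0" "(LINT x|lborel. norm (\<psi> x) ^ 4) \<le> M"
  shows "(\<integral>\<^sup>+x. ennreal ((\<bar>V x\<bar> * norm (\<psi> x)) powr (4/3)) \<partial>lborel) \<le> ennreal (W powr (2/3) * M powr (1/3))"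
proof -
  let ?K = "W powr (2/3) * M powr (1/3)"
  let ?h = "\<lambda>x. ?K * (2/3 * ((V x)\<^sup>2 / W) + 1/3 * (norm (\<psi> x) ^ 4 / M))"
  have i1: "integrable lborel (\<lambda>x. 2/3 * ((V x)\<^sup>2 / W))"
    by (intro integrable_mult_right integrable_divide integrable_V)
  have i2: "integrable lborel (\<lambda>x. 1/3 * (norm (\<psi> x) ^ 4 / M))"
    by (intro integrable_mult_right integrable_divide integrable_\<psi>)
  have int: "integrable lborel ?h"
    by (intro integrable_mult_right Bochner_Integration.integrable_add i1 i2)
  have "(\<integral>\<^sup>+x. ennreal ((\<bar>V x\<bar> * norm (\<psi> x)) powr (4/3)) \<partial>lborel) \<le> (\<integral>\<^sup>+x. ennreal (?h x) \<partial>lborel)"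
    using young_weighted[of "\<bar>V x\<bar>" "norm (\<psi> x)" W M for x] W M
    by (intro nn_integral_mono ennreal_leI) auto
  also have "\<dots> = ennreal (LINT x|lborel. ?h x)"
    using W M by (intro nn_integral_eq_integral int) auto
  also have "(LINT x|lborel. ?h x) = ?K * (2/3 * ((LINT x|lborel. (V x)\<^sup>2) / W) + 1/3 * ((LINT x|lborel. norm (\<psi> x) ^ 4) / M))"
    using Bochner_Integration.integral_add[OF i1 i2] by simp
  also have "\<dots> \<le> ?K * (2/3 * 1 + 1/3 * 1)"
    using W M by (intro mult_left_mono add_mono) auto
  finally show ?thesis by (simp add: ennreal_leI)
qed

text \<open>Duality between L^4 and L^(4/3), tested with the cube of the component \<open>P\<close>.
  The truncated integrals satisfy I <= C I^(3/4) F^(3/4); being finite and positive, I can be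
  divided out, and the bound passes to the limit of the truncations.\<close>

lemma integral_component_le:
  assumes pos: "F > 0"
    and F: "(\<integral>\<^sup>+x. ennreal ((\<bar>V x\<bar> * norm (\<psi> x)) powr (4/3)) \<partial>lborel) \<le> ennreal F"
    and b: "b \<in> Basis"
  shows "integrable lborel (\<lambda>x. (\<psi> x \<bullet> b) ^ 4)"
    and "(LINT x|lborel. (\<psi> x \<bullet> b) ^ 4) \<le> sobolev_const ^ 4 * F ^ 3"
proof -
  define P where "P x = \<psi> x \<bullet> b" for x
  have [measurable]: "P \<in> borel_measurable borel" unfolding P_def by measurable
  have P_le: "\<bar>P x\<bar> \<le> norm (\<psi> x)" for x
    using b by (simp add: P_def Basis_le_norm)
  have P4: "P x ^ 4 = \<bar>P x\<bar> ^ 4" for x by (rule power_even_abs[symmetric]) simp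
  have int: "integrable lborel (\<lambda>x. P x ^ 4)"
  proof (rule Bochner_Integration.integrable_bound[OF integrable_\<psi>])
    show "AE x in lborel. norm (P x ^ 4) \<le> norm (norm (\<psi> x) ^ 4)"
      using power_mono[OF P_le abs_ge_zero, of _ 4] by (intro AE_I2) (simp add: power_abs)
  qed measurable
  then show "integrable lborel (\<lambda>x. (\<psi> x \<bullet> b) ^ 4)" by (simp only: P_def)
  \<comment> \<open>Truncating both the value and the position makes the weight bounded with bounded
    support, as the pairing bound requires.\<close>
  define S where "S n = {x. \<bar>P x\<bar> \<le> real n \<and> norm x \<le> real n}" for n
  have [measurable]: "S n \<in> sets borel" for n
  proof -
    have "{x \<in> space borel. \<bar>P x\<bar> \<le> real n \<and> norm x \<le> real n} \<in> sets borel" by measurable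
    then show ?thesis by (simp add: S_def)
  qed
  define I where "I n = (LINT x|lborel. indicator (S n) x * P x ^ 4)" for n
  have I_le: "I n \<le> sobolev_const ^ 4 * F ^ 3" for n
  proof (cases "I n > 0")
    case False
    moreover have "0 \<le> sobolev_const ^ 4 * F ^ 3" using sobolev_const_pos pos by simp
    ultimately show ?thesis by linarith
  next
    case True
    \<comment> \<open>The power 4/3 of |g| and the product of g with \<open>P\<close> are the same
      function, whose integral is \<open>I n\<close>.\<close>
    define g where "g x = indicator (S n) x * P x ^ 3" for x
    have [measurable]: "g \<in> borel_measurable borel" unfolding g_def by measurable
    have gP: "\<bar>g x\<bar> powr (4/3) = indicator (S n) x * P x ^ 4" for x
    proof (cases "P x = 0")
      case False
      then have "(\<bar>P x\<bar> ^ 3) powr (4/3) = (\<bar>P x\<bar> powr 3) powr (4/3)"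
        using powr_numeral[of "\<bar>P x\<bar>" "num.Bit1 num.One"] by simp
      also have "\<dots> = \<bar>P x\<bar> ^ 4"
        using False powr_numeral[of "\<bar>P x\<bar>" "num.Bit0 (num.Bit0 num.One)"] by (simp only: powr_powr) simp
      finally show ?thesis by (simp add: g_def indicator_def power_abs)
    qed (simp add: g_def)
    have "bump_mass * norm (LINT x|lborel. g x *\<^sub>R \<psi> x)
        \<le> 8 * (1 + 2 * decay_const) * ((2 * I n) powr (3/4) * F powr (3/4))"
    proof (rule pairing_bound[OF _ _ _ pos _ F])
      show "\<bar>g x\<bar> \<le> real n ^ 3" for x
        by (auto simp: g_def S_def indicator_def power_abs intro!: power_mono)
      show "norm x > real n \<Longrightarrow> g x = 0" for x
        by (simp add: g_def S_def)
      \<comment> \<open>Any number above \<open>I n\<close> would do; the factor 2 is the one built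
        into \<open>sobolev_const\<close>.\<close>
      show "(LINT x|lborel. \<bar>g x\<bar> powr (4/3)) < 2 * I n"
        using True by (simp add: gP I_def)
    qed measurable
    moreover have "I n \<le> norm (LINT x|lborel. g x *\<^sub>R \<psi> x)"
    proof -
      have "integrable lborel (\<lambda>x. g x *\<^sub>R \<psi> x)"
      proof (rule Bochner_Integration.integrable_bound[OF integrable_\<psi>])
        show "AE x in lborel. norm (g x *\<^sub>R \<psi> x) \<le> norm (norm (\<psi> x) ^ 4)"
        proof (rule AE_I2)
          fix x
          have "\<bar>g x\<bar> \<le> norm (\<psi> x) ^ 3"
            using power_mono[OF P_le abs_ge_zero, of x 3] by (simp add: g_def indicator_def power_abs)
          then have "\<bar>g x\<bar> * norm (\<psi> x) \<le> norm (\<psi> x) ^ 3 * norm (\<psi> x)"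
            by (rule mult_right_mono) simp
          then show "norm (g x *\<^sub>R \<psi> x) \<le> norm (norm (\<psi> x) ^ 4)"
            by (simp add: power_numeral_reduce mult_ac)
        qed
      qed measurable
      then have "(LINT x|lborel. g x *\<^sub>R \<psi> x) \<bullet> b = (LINT x|lborel. (g x *\<^sub>R \<psi> x) \<bullet> b)"
        by (rule integral_inner_left[symmetric])
      also have "\<dots> = I n"
        unfolding I_def by (intro Bochner_Integration.integral_cong) (auto simp: g_def P_def power_numeral_reduce)
      finally show ?thesis using Basis_le_norm[OF b] by (metis abs_le_D1)
    qed
    ultimately have "bump_mass * I n \<le> 8 * (1 + 2 * decay_const) * ((2 * I n) powr (3/4) * F powr (3/4))"
      using bump_mass_pos by (meson mult_left_mono less_imp_le order_trans)
    also have "\<dots> = bump_mass * (sobolev_const * (I n powr (3/4) * F powr (3/4)))"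
      using bump_mass_pos True by (simp add: sobolev_const_def powr_mult)
    finally have "I n \<le> sobolev_const * (I n powr (3/4) * F powr (3/4))"
      using bump_mass_pos by simp
    moreover have "I n = I n powr (1/4) * I n powr (3/4)"
      using True by (simp flip: powr_add)
    ultimately have "I n powr (1/4) * I n powr (3/4) \<le> (sobolev_const * F powr (3/4)) * I n powr (3/4)"
      by (simp add: mult_ac)
    then have "I n powr (1/4) \<le> sobolev_const * F powr (3/4)"
      using True by simp
    then have "(I n powr (1/4)) ^ 4 \<le> (sobolev_const * F powr (3/4)) ^ 4"
      by (intro power_mono) auto
    also have "\<dots> = sobolev_const ^ 4 * F powr 3"
      using pos by (simp add: power_mult_distrib powr_power)
    also have "F powr 3 = F ^ 3" using pos powr_numeral[of F "num.Bit1 num.One"] by simp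
    also have "(I n powr (1/4)) ^ 4 = I n" using True by (simp add: powr_power)
    finally show ?thesis .
  qed
  have "I \<longlonglongrightarrow> (LINT x|lborel. P x ^ 4)"
    unfolding I_def
  proof (rule integral_dominated_convergence[OF _ _ int])
    show "AE x in lborel. (\<lambda>n. indicator (S n) x * P x ^ 4) \<longlonglongrightarrow> P x ^ 4"
    proof (rule AE_I2)
      fix x
      obtain N :: nat where N: "max \<bar>P x\<bar> (norm x) \<le> real N" using real_arch_simple by blast
      have "\<forall>\<^sub>F n in sequentially. indicator (S n) x * P x ^ 4 = P x ^ 4"
        by (rule eventually_sequentiallyI[of N]) (use N in \<open>auto simp: S_def indicator_def\<close>)
      then show "(\<lambda>n. indicator (S n) x * P x ^ 4) \<longlonglongrightarrow> P x ^ 4" by (rule tendsto_eventually)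
    qed
    show "AE x in lborel. norm (indicator (S n) x * P x ^ 4) \<le> P x ^ 4" for n
      by (auto simp: indicator_def)
  qed measurable
  then have "(LINT x|lborel. P x ^ 4) \<le> sobolev_const ^ 4 * F ^ 3"
    by (rule LIMSEQ_le_const2) (use I_le in auto)
  then show "(LINT x|lborel. (\<psi> x \<bullet> b) ^ 4) \<le> sobolev_const ^ 4 * F ^ 3" by (simp only: P_def)
qed

lemma card_Basis_spinor: "card (Basis :: spinor set) = 4"
  using DIM_cart[where 'a=complex and 'b=2] by simp

text \<open>Summing the component bounds and inserting Hoelder's inequality gives M <= 16 C^4 W^2 M
  with C = \<open>sobolev_const\<close>. Since M is finite, smallness of W excludes M > 0.\<close>

lemma vanishing:
  assumes W: "W > 0" "(LINT x|lborel. (V x)\<^sup>2) \<le> W" and small: "16 * sobolev_const ^ 4 * W\<^sup>2 < 1"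
  shows "AE x in lborel. \<psi> x = 0"
proof -
  define M where "M = (LINT x|lborel. norm (\<psi> x) ^ 4)"
  have "M \<ge> 0" by (simp add: M_def)
  have "\<not> M > 0"
  proof
    assume M: "M > 0"
    define F where "F = W powr (2/3) * M powr (1/3)"
    have F: "F > 0" using W M by (simp add: F_def)
    have src: "(\<integral>\<^sup>+x. ennreal ((\<bar>V x\<bar> * norm (\<psi> x)) powr (4/3)) \<partial>lborel) \<le> ennreal F"
      unfolding F_def by (rule nn_integral_source[OF W M]) (simp add: M_def)
    note comp = integral_component_le[OF F src]
    have int: "integrable lborel (\<lambda>x. 4 * (\<Sum>b\<in>Basis. (\<psi> x \<bullet> b) ^ 4))"
      by (intro integrable_mult_right Bochner_Integration.integrable_sum comp)
    have "M \<le> (LINT x|lborel. 4 * (\<Sum>b\<in>Basis. (\<psi> x \<bullet> b) ^ 4))"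
      unfolding M_def
    proof (rule Bochner_Integration.integral_mono[OF integrable_\<psi> int])
      fix x
      have "norm (\<psi> x) ^ 4 = ((norm (\<psi> x))\<^sup>2)\<^sup>2" by (simp flip: power_mult)
      also have "(norm (\<psi> x))\<^sup>2 = (\<Sum>b\<in>Basis. (\<psi> x \<bullet> b)\<^sup>2)"
        unfolding power2_norm_eq_inner by (subst euclidean_inner) (simp add: power2_eq_square)
      \<comment> \<open>Cauchy-Schwarz over the four real components costs a factor 4; summing four
        equal bounds costs another, whence 16.\<close>
      also have "(\<Sum>b\<in>Basis. (\<psi> x \<bullet> b)\<^sup>2)\<^sup>2 \<le> (\<Sum>b\<in>Basis. ((\<psi> x \<bullet> b)\<^sup>2)\<^sup>2) * card (Basis :: spinor set)"
        by (rule sum_squared_le_sum_of_squares)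
      also have "\<dots> = 4 * (\<Sum>b\<in>Basis. (\<psi> x \<bullet> b) ^ 4)"
        by (simp add: card_Basis_spinor flip: power_mult)
      finally show "norm (\<psi> x) ^ 4 \<le> 4 * (\<Sum>b\<in>Basis. (\<psi> x \<bullet> b) ^ 4)" .
    qed
    also have "\<dots> = 4 * (\<Sum>b\<in>Basis. (LINT x|lborel. (\<psi> x \<bullet> b) ^ 4))"
      using comp by simp
    also have "\<dots> \<le> 4 * (\<Sum>b\<in>(Basis :: spinor set). sobolev_const ^ 4 * F ^ 3)"
      by (intro mult_left_mono sum_mono comp) auto
    also have "\<dots> = 16 * sobolev_const ^ 4 * F ^ 3"
      by (simp add: card_Basis_spinor)
    also have "F ^ 3 = W\<^sup>2 * M"
      using W M by (simp add: F_def power_mult_distrib powr_power powr_numeral)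
    also have "16 * sobolev_const ^ 4 * (W\<^sup>2 * M) = (16 * sobolev_const ^ 4 * W\<^sup>2) * M" by simp
    also have "\<dots> < 1 * M" using small M by (intro mult_strict_right_mono)
    finally show False by simp
  qed
  with \<open>M \<ge> 0\<close> have "M = 0" by simp
  then have "AE x in lborel. norm (\<psi> x) ^ 4 = 0"
    unfolding M_def by (subst integral_nonneg_eq_0_iff_AE[OF integrable_\<psi>, symmetric]) auto
  then show ?thesis by (auto elim!: eventually_mono)
qed

end

section \<open>Borel versions\<close>

text \<open>Compact annuli exhaust the punctured plane, and on each of them integrability includes
  measurability. The value at 0 is put back separately.\<close>

lemma measurable_if_locally_integrable:
  fixes f :: "plane \<Rightarrow> 'b::{banach, second_countable_topology}"
  assumes "locally_integrable_on f (UNIV - {0})"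
  shows "f \<in> borel_measurable lebesgue"
proof -
  define K where "K n = cball (0::plane) (real n) - ball 0 (1 / real (Suc n))" for n
  have K: "compact (K n)" "K n \<subseteq> UNIV - {0}" for n
    by (auto simp: K_def intro: compact_diff)
  have [measurable]: "(\<lambda>x. indicator (K n) x *\<^sub>R f x) \<in> borel_measurable lebesgue" for n
    using assms K[of n] unfolding locally_integrable_on_def set_integrable_def by auto
  have "(\<lambda>x. if x = 0 then 0 else f x) \<in> borel_measurable lebesgue"
  proof (rule borel_measurable_LIMSEQ_metric)
    fix x :: plane
    show "(\<lambda>n. indicator (K n) x *\<^sub>R f x) \<longlonglongrightarrow> (if x = 0 then 0 else f x)"
    proof (cases "x = 0")
      case True
      then show ?thesis by (simp add: K_def)
    next
      case False
      obtain N :: nat where N: "real N > max (norm x) (1 / norm x)" using reals_Archimedean2 by blast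
      have "\<forall>\<^sub>F n in sequentially. indicator (K n) x *\<^sub>R f x = (if x = 0 then 0 else f x)"
      proof (rule eventually_sequentiallyI[of N])
        fix n assume "N \<le> n"
        then have n: "real n > norm x" "real (Suc n) > 1 / norm x" using N by auto
        then have "1 / real (Suc n) \<le> norm x" using False by (simp add: field_simps)
        then have "x \<in> K n" using n by (simp add: K_def)
        then show "indicator (K n) x *\<^sub>R f x = (if x = 0 then 0 else f x)" using False by simp
      qed
      then show ?thesis by (rule tendsto_eventually)
    qed
  qed measurable
  then have "(\<lambda>x. (if x = 0 then 0 else f x) + indicator {0} x *\<^sub>R f 0) \<in> borel_measurable lebesgue"
    by (intro borel_measurable_add borel_measurable_scaleR borel_measurable_indicator borel_measurable_const) auto
  moreover have "(\<lambda>x. (if x = 0 then 0 else f x) + indicator {0} x *\<^sub>R f 0) = f"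
    by (auto simp: indicator_def)
  ultimately show ?thesis by simp
qed

lemma lebesgue_measurable_borel_version:
  fixes f :: "'a::euclidean_space \<Rightarrow> 'b::euclidean_space"
  assumes "f \<in> borel_measurable lebesgue"
  obtains f' where "f' \<in> borel_measurable borel" "AE x in lborel. f x = f' x"
proof -
  have "\<exists>h\<in>borel_measurable lborel. AE x in lborel. f x \<bullet> b = h x" for b
    by (intro completion_ex_borel_measurable_real borel_measurable_inner assms borel_measurable_const)
  then obtain h where h: "\<And>b. h b \<in> borel_measurable lborel" "\<And>b. AE x in lborel. f x \<bullet> b = h b x"
    by metis
  show ?thesis
  proof
    show "(\<lambda>x. \<Sum>b\<in>Basis. h b x *\<^sub>R b) \<in> borel_measurable borel"
      using h(1) by (intro borel_measurable_sum borel_measurable_scaleR) auto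
    have "AE x in lborel. \<forall>b\<in>Basis. f x \<bullet> b = h b x"
      using h(2) by (intro AE_finite_allI) auto
    then show "AE x in lborel. f x = (\<Sum>b\<in>Basis. h b x *\<^sub>R b)"
    proof eventually_elim
      case (elim x)
      then have "(\<Sum>b\<in>Basis. h b x *\<^sub>R b) = (\<Sum>b\<in>Basis. (f x \<bullet> b) *\<^sub>R b)" by simp
      then show ?case by (simp add: euclidean_representation)
    qed
  qed
qed

lemma integral_lebesgue_version:
  fixes f g :: "plane \<Rightarrow> 'b::{banach, second_countable_topology}"
  assumes f: "f \<in> borel_measurable lebesgue" and g: "g \<in> borel_measurable borel"
    and eq: "AE x in lborel. f x = g x"
  shows "(LINT x|lebesgue. f x) = (LINT x|lborel. g x)"
    and "integrable lebesgue f \<longleftrightarrow> integrable lborel g"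
proof -
  have g': "g \<in> borel_measurable lborel" using g by simp
  then have "g \<in> borel_measurable lebesgue" by (rule measurable_completion)
  note cong = f this AE_completion[OF eq]
  show "(LINT x|lebesgue. f x) = (LINT x|lborel. g x)"
    using Bochner_Integration.integral_cong_AE[OF cong] integral_completion[OF g'] by simp
  show "integrable lebesgue f \<longleftrightarrow> integrable lborel g"
    using integrable_cong_AE[OF cong] integrable_completion[OF g'] by simp
qed

lemma test_function_measurable:
  assumes "\<phi> \<in> test_functions U"
  shows "\<phi> \<in> borel_measurable borel" "(\<lambda>x. frechet_derivative \<phi> (at x) v) \<in> borel_measurable borel"
proof -
  have "C_k 0 \<phi>" "C_k (Suc 0) \<phi>" using assms by (auto simp only: test_functions_def mem_Collect_eq)
  then show "\<phi> \<in> borel_measurable borel" "(\<lambda>x. frechet_derivative \<phi> (at x) v) \<in> borel_measurable borel"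
    by (auto intro: borel_measurable_continuous_onI)
qed

text \<open>Measurability is extracted from the integrability hypotheses: that of \<psi> from local
  integrability, that of e^u from e^(2u). No measurability of \<open>u\<close> is assumed.\<close>

lemma dirac_solution_version:
  assumes "clifford e" and weak: "weak_dirac_solution_on (UNIV - {0}) e u \<psi>"
    and u: "integrable lebesgue (\<lambda>x. exp (2 * u x))"
    and \<psi>: "integrable lebesgue (\<lambda>x. norm (\<psi> x) ^ 4)"
  obtains \<psi>' V where "dirac_solution e \<psi>' V" "AE x in lborel. \<psi> x = \<psi>' x"
    "(LINT x|lborel. (V x)\<^sup>2) = (LINT x|lebesgue. exp (2 * u x))"
proof -
  have \<psi>m [measurable]: "\<psi> \<in> borel_measurable lebesgue"
    using weak by (intro measurable_if_locally_integrable) (simp add: weak_dirac_solution_on_def)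
  have um: "(\<lambda>x. exp (2 * u x)) \<in> borel_measurable lebesgue"
    using u by (rule borel_measurable_integrable)
  have exp_sq: "exp (2 * t) = (exp t)\<^sup>2" for t :: real by (simp add: exp_double)
  \<comment> \<open>The square root recovers e^u from its integrable square.\<close>
  then have sqrt: "exp (u x) = sqrt (exp (2 * u x))" for x by simp
  have expm: "(\<lambda>x. exp (u x)) \<in> borel_measurable lebesgue"
    unfolding sqrt by (rule measurable_compose[OF um borel_measurable_sqrt])
  obtain \<psi>' where \<psi>' [measurable]: "\<psi>' \<in> borel_measurable borel" and \<psi>_eq: "AE x in lborel. \<psi> x = \<psi>' x"
    using lebesgue_measurable_borel_version[OF \<psi>m] .
  obtain V where V [measurable]: "V \<in> borel_measurable borel" and V_eq: "AE x in lborel. exp (u x) = V x"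
    using lebesgue_measurable_borel_version[OF expm] .
  have V_sq: "AE x in lborel. exp (2 * u x) = (V x)\<^sup>2"
    using V_eq by eventually_elim (simp add: exp_sq)
  have V2: "(\<lambda>x. (V x)\<^sup>2) \<in> borel_measurable borel" by measurable
  have \<psi>4: "AE x in lborel. norm (\<psi> x) ^ 4 = norm (\<psi>' x) ^ 4"
    using \<psi>_eq by eventually_elim simp
  have "dirac_solution e \<psi>' V"
  proof
    show "integrable lborel (\<lambda>x. norm (\<psi>' x) ^ 4)"
      using \<psi> integral_lebesgue_version(2)[OF borel_measurable_integrable[OF \<psi>] _ \<psi>4] by simp
    show "integrable lborel (\<lambda>x. (V x)\<^sup>2)"
      using u integral_lebesgue_version(2)[OF um V2 V_sq] by simp
    fix \<phi> assume \<phi>: "\<phi> \<in> test_functions (UNIV - {0})"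
    note [measurable] = test_function_measurable[OF \<phi>]
    have to_lebesgue: "h \<in> borel_measurable lebesgue" if "h \<in> borel_measurable borel" for h :: "plane \<Rightarrow> real"
      using that by (intro measurable_completion) simp
    have deriv: "distr_of \<psi> (\<lambda>x. frechet_derivative \<phi> (at x) (axis i 1))
        = (LINT x|lborel. frechet_derivative \<phi> (at x) (axis i 1) *\<^sub>R \<psi>' x)" for i
      unfolding distr_of_def
    proof (rule integral_lebesgue_version(1))
      show "AE x in lborel. frechet_derivative \<phi> (at x) (axis i 1) *\<^sub>R \<psi> x
          = frechet_derivative \<phi> (at x) (axis i 1) *\<^sub>R \<psi>' x"
        using \<psi>_eq by eventually_elim simp
    qed (intro borel_measurable_scaleR to_lebesgue test_function_measurable[OF \<phi>] \<psi>m \<psi>')+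
    have rhs: "(LINT x|lebesgue. \<phi> x *\<^sub>R - (exp (u x) *\<^sub>R \<psi> x)) = (LINT x|lborel. - (\<phi> x *\<^sub>R V x *\<^sub>R \<psi>' x))"
    proof (rule integral_lebesgue_version(1))
      show "AE x in lborel. \<phi> x *\<^sub>R - (exp (u x) *\<^sub>R \<psi> x) = - (\<phi> x *\<^sub>R V x *\<^sub>R \<psi>' x)"
        using \<psi>_eq V_eq by eventually_elim simp
    qed (intro borel_measurable_scaleR borel_measurable_uminus to_lebesgue test_function_measurable[OF \<phi>] \<psi>m \<psi>' expm V)+
    have "distr_dirac e (distr_of \<psi>) \<phi> = distr_of (\<lambda>x. - (exp (u x) *\<^sub>R \<psi> x)) \<phi>"
      using weak \<phi> by (simp add: weak_dirac_solution_on_def)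
    then have "(\<Sum>i\<in>UNIV. e i *v - (LINT x|lborel. frechet_derivative \<phi> (at x) (axis i 1) *\<^sub>R \<psi>' x))
        = - (LINT x|lborel. \<phi> x *\<^sub>R V x *\<^sub>R \<psi>' x)"
      unfolding distr_dirac_def distr_partial_def deriv distr_of_def[of _ \<phi>] rhs
      by (simp only: Bochner_Integration.integral_minus)
    moreover have "A *v - w = - (A *v w)" for A :: "complex^2^2" and w
      using linear_neg[OF matrix_vector_mul_linear, of A w] by simp
    ultimately show "(\<Sum>i\<in>UNIV. e i *v (LINT x|lborel. frechet_derivative \<phi> (at x) (axis i 1) *\<^sub>R \<psi>' x))
        = (LINT x|lborel. \<phi> x *\<^sub>R V x *\<^sub>R \<psi>' x)"
      by (simp only: sum_negf neg_equal_iff_equal)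
  qed (use assms \<psi>' V in simp_all)
  then show ?thesis
    using that \<psi>_eq integral_lebesgue_version(1)[OF um V2 V_sq] by simp
qed

text \<open>Integrability is stated alongside the integral bound because a Bochner integral is 0 by
  default when it does not exist. A weak solution is determined only up to null sets, so vanishing
  means almost everywhere.\<close>

theorem lemma5p2:
  shows "\<exists>\<epsilon>\<^sub>1::real. \<epsilon>\<^sub>1 > 0 \<and>
    (\<forall>(e :: 2 \<Rightarrow> complex^2^2) (u :: real^2 \<Rightarrow> real) (\<psi> :: real^2 \<Rightarrow> complex^2).
       clifford e \<longrightarrow>
       weak_dirac_solution_on (UNIV - {0}) e u \<psi> \<longrightarrow>
       integrable lebesgue (\<lambda>x. exp (2 * u x)) \<longrightarrow>
       (LINT x|lebesgue. exp (2 * u x)) \<le> \<epsilon>\<^sub>1 \<longrightarrow>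
       integrable lebesgue (\<lambda>x. norm (\<psi> x) ^ 4) \<longrightarrow>
       (AE x in lebesgue. \<psi> x = 0))"
proof (intro exI[of _ "1 / (8 * sobolev_const\<^sup>2)"] conjI allI impI)
  show pos: "0 < 1 / (8 * sobolev_const\<^sup>2)" using sobolev_const_pos by simp
  fix e :: "2 \<Rightarrow> complex^2^2" and u :: "real^2 \<Rightarrow> real" and \<psi> :: "real^2 \<Rightarrow> complex^2"
  assume "clifford e" "weak_dirac_solution_on (UNIV - {0}) e u \<psi>"
    "integrable lebesgue (\<lambda>x. exp (2 * u x))" "integrable lebesgue (\<lambda>x. norm (\<psi> x) ^ 4)"
    and le: "(LINT x|lebesgue. exp (2 * u x)) \<le> 1 / (8 * sobolev_const\<^sup>2)"
  then obtain \<psi>' V where sol: "dirac_solution e \<psi>' V" and eq: "AE x in lborel. \<psi> x = \<psi>' x"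
    and V: "(LINT x|lborel. (V x)\<^sup>2) = (LINT x|lebesgue. exp (2 * u x))"
    using dirac_solution_version by blast
  \<comment> \<open>For W = 1/(8 C^2) the absorption factor 16 C^4 W^2 equals 1/4.\<close>
  have "16 * sobolev_const ^ 4 * (1 / (8 * sobolev_const\<^sup>2))\<^sup>2 < 1"
    using sobolev_const_pos by (simp add: power_divide power_mult_distrib flip: power_mult)
  then have "AE x in lborel. \<psi>' x = 0"
    using V le by (intro dirac_solution.vanishing[OF sol pos]) auto
  with eq have "AE x in lborel. \<psi> x = 0" by eventually_elim simp
  then show "AE x in lebesgue. \<psi> x = 0" by (rule AE_completion)
qed

end
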